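(* Let $g_\sigma:\mathbb R^n\to\mathbb R\cup\{+\infty\}$ be of class $\mathcal C^2$ with $L$-Lipschitz continuous gradient, $L<1$, and let $\mathcal D_\sigma=I-\nabla g_\sigma$. Let $f:\mathbb R^n\to\mathbb R\cup\{+\infty\}$ and $h$ be differentiable with $L_f$- and $L_h$-Lipschitz continuous gradients respectively, and let $l_f$ be a constant such that $f+\frac{l_f}{2}\|\cdot\|^2$ is convex. Suppose that $f$, $g_\sigma$ and $h$ are bounded from below. Let $\alpha,\gamma$ satisfy $$0<\gamma<\frac1{L_f+L_h},\qquad 0\le\alpha<\frac{1-\gamma l_f-2\gamma L_h}{2+\gamma L_h}-\gamma^2L_f^2 .$$ Let $\{(\mathbf y^k,\mathbf z^k,\mathbf x^k)\}_{k\ge1}$ be generated by the smooth extrapolated PnP-DYS iteration: given $\mathbf x^0$ and $\mathbf x^{-1}=\mathbf x^0$, for $k=0,1,2,\dots$, $$\mathbf w^k=\mathbf x^k+\alpha(\mathbf x^k-\mathbf x^{k-1}),\quad \mathbf y^{k+1}=\mathrm{Prox}_{\gamma f}(\mathbf w^k),\quad \mathbf z^{k+1}=\mathcal D_\sigma(2\mathbf y^{k+1}-\gamma\nabla h(\mathbf y^{k+1})-\mathbf w^k),\quad \mathbf x^{k+1}=\mathbf w^k+(\mathbf z^{k+1}-\mathbf y^{k+1}),$$ and assume this sequence is bounded. Then: (i) the sequence $\{\widetilde\Theta_{\alpha,\gamma}(\mathbf y^k,\mathbf z^k,\mathbf x^k,\mathbf x^{k-1},\mathbf x^{k-2})\}_{k\ge1}$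 is nonincreasing and converges; (ii) the sequences $\{\mathbf x^k-\mathbf x^{k-1}\}$, $\{\mathbf y^k-\mathbf y^{k-1}\}$ and $\{\mathbf y^k-\mathbf z^k\}$ vanish (converge to $0$), with rates $\min_{1\le k\le K}\|\mathbf x^k-\mathbf x^{k-1}\|=\mathcal O(1/\sqrt K)$, $\min_{2\le k\le K}\|\mathbf y^k-\mathbf y^{k-1}\|=\mathcal O(1/\sqrt K)$ and $\min_{1\le k\le K}\|\mathbf y^k-\mathbf z^k\|=\mathcal O(1/\sqrt K)$; (iii) any cluster point $\mathbf u^*=(\mathbf y^*,\mathbf z^*,\mathbf x^*,\mathbf x^*,\mathbf x^* )$ of the sequence $\mathbf u^k=(\mathbf y^k,\mathbf z^k,\mathbf x^k,\mathbf x^{k-1},\mathbf x^{k-2})$, $k\ge1$, is a critical point of the problem $\min F_{\gamma,\sigma}$, i.e., $0\in\partial F_{\gamma,\sigma}(\mathbf y^* )$; (iv) if $h$ is twice continuously differentiable with bounded Hessian, i.e., there exists $M>0$ such that $\|\nabla^2h(\mathbf y)\|\le M$ for all $\mathbf y\in\mathbb R^n$, and $F_{\gamma,\sigma}$ is a KL function, then the whole sequence $\{\mathbf u^k\}_{k\ge1}$ is convergent.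
   Context: For $\gamma>0$, $\mathrm{Prox}_{\gamma f}(\mathbf x)=\arg\min_{\mathbf y\in\mathbb R^n}\{f(\mathbf y)+\frac1{2\gamma}\|\mathbf y-\mathbf x\|^2\}$. The function $\phi_\sigma$ is defined by $\phi_\sigma(\mathbf x)=g_\sigma(\mathcal D_\sigma^{-1}(\mathbf x))-\frac12\|\mathcal D_\sigma^{-1}(\mathbf x)-\mathbf x\|^2$ if $\mathbf x\in\mathrm{Im}(\mathcal D_\sigma)$ and $\phi_\sigma(\mathbf x)=+\infty$ otherwise ($\mathcal D_\sigma$ is injective since $L<1$). It is known that $\mathcal D_\sigma(\mathbf x)=\mathrm{Prox}_{\phi_\sigma}(\mathbf x)$. The objective is $F_{\gamma,\sigma}(\mathbf x)=f(\mathbf x)+\frac1\gamma\phi_\sigma(\mathbf x)+h(\mathbf x)$ on $\mathbb R^n$. Define $$\widetilde{\mathcal H}_\gamma(\mathbf y,\mathbf z,\mathbf x)=f(\mathbf y)+\tfrac1\gamma\phi_\sigma(\mathbf z)+h(\mathbf y)+\tfrac1{2\gamma}\|\mathbf y-\mathbf x-\gamma\nabla h(\mathbf y)\|^2-\tfrac1{2\gamma}\|\mathbf z-\mathbf x-\gamma\nabla h(\mathbf y)\|^2,$$ $$\widetilde\Theta_{\alpha,\gamma}(\mathbf y,\mathbf z,\mathbf x,\mathbf x_1,\mathbf x_2)=\widetilde{\mathcal H}_\gamma(\mathbf y,\mathbf z,\mathbf x)+\tfrac{\alpha^2}{2\gamma}\|\mathbf x_1-\mathbf x_2\|^2.$$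 Limiting subdifferential: $\widehat\partial F(\mathbf x)$ (for $\mathbf x\in\mathrm{dom} F$) is the set of $\mathbf u$ with $\liminf_{\mathbf y\ne\mathbf x,\mathbf y\to\mathbf x}\frac{F(\mathbf y)-F(\mathbf x)-\langle\mathbf u,\mathbf y-\mathbf x\rangle}{\|\mathbf y-\mathbf x\|}\ge0$ (empty if $\mathbf x\notin\mathrm{dom} F$), and $\partial F(\mathbf x)=\{\mathbf u:\exists\,\mathbf x^k\to\mathbf x,\ F(\mathbf x^k)\to F(\mathbf x),\ \mathbf u^k\in\widehat\partial F(\mathbf x^k),\ \mathbf u^k\to\mathbf u\}$. $\mathrm{dist}(\mathbf x,S)=\inf_{\mathbf y\in S}\|\mathbf y-\mathbf x\|$, equal to $\infty$ if $S=\emptyset$. KL function: a proper lower semicontinuous $F:\mathbb R^n\to(-\infty,+\infty]$ has the KL property at $\mathbf x^*\in\mathrm{dom}(\partial F)$ if there exist $\eta\in(0,+\infty]$, a neighborhood $U$ of $\mathbf x^*$, and a continuous concave $\varphi:[0,\eta)\to\mathbb R_+$ with $\varphi(0)=0$, $\varphi$ continuously differentiable on $(0,\eta)$ with $\varphi'>0$, such that $\varphi'(F(\mathbf x)-F(\mathbf x^* ))\,\mathrm{dist}(0,\partial F(\mathbf x))\ge1$ for all $\mathbf x\in U$ with $F(\mathbf x^* )<F(\mathbf x)<F(\mathbf x^* )+\eta$. $F$ is a KL function if it has the KL property at each point of $\mathrm{dom}(\partial F)$. *)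

theory Defs
  imports "HOL-Analysis.Analysis" "HOL-Library.Landau_Symbols"
begin

definition grad :: "('a::euclidean_space \<Rightarrow> real) \<Rightarrow> 'a \<Rightarrow> 'a" where
  "grad f x = (THE v. GDERIV f x :> v)"

lemma GDERIV_grad:
  fixes f :: "'a::euclidean_space \<Rightarrow> real"
  assumes "f differentiable (at x)"
  shows "GDERIV f x :> grad f x"
proof -
  obtain f' where f': "(f has_derivative f') (at x)"
    using assms unfolding differentiable_def by blast
  then interpret bounded_linear f' by (rule has_derivative_bounded_linear)
  define v where "v = (\<Sum>b\<in>Basis. f' b *\<^sub>R b)"
  have "f' u = inner u v" for u
  proof -
    have "f' u = f' (\<Sum>b\<in>Basis. (u \<bullet> b) *\<^sub>R b)" by (simp add: euclidean_representation)
    also have "\<dots> = (\<Sum>b\<in>Basis. (u \<bullet> b) * f' b)" by (simp only: sum scale real_scaleR_def)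
    also have "\<dots> = inner u v"
      by (simp add: v_def inner_sum_right mult.commute)
    finally show ?thesis .
  qed
  then have "f' = (\<lambda>u. inner u v)" by (rule ext)
  with f' have v: "GDERIV f x :> v" by (simp add: gderiv_def)
  have "w = v" if "GDERIV f x :> w" for w
  proof -
    have "(\<lambda>u. inner u w) = (\<lambda>u. inner u v)"
      using that v unfolding gderiv_def by (rule has_derivative_unique)
    then have "inner u w = inner u v" for u by (rule fun_cong)
    then show "w = v" using vector_eq_ldot[of w v] by blast
  qed
  with v show ?thesis unfolding grad_def by (rule theI)
qed

text \<open>The Hessian is the derivative of the gradient, a bounded operator; its norm is the
  operator norm.\<close>

definition Hess :: "('a::euclidean_space \<Rightarrow> real) \<Rightarrow> 'a \<Rightarrow> 'a \<Rightarrow>\<^sub>L 'a" where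
  "Hess f x = Blinfun (frechet_derivative (grad f) (at x))"

definition C2 :: "('a::euclidean_space \<Rightarrow> real) \<Rightarrow> bool" where
  "C2 f \<longleftrightarrow> (\<forall>x. f differentiable (at x)) \<and> (\<forall>x. grad f differentiable (at x))
     \<and> continuous_on UNIV (Hess f)"

definition effective_domain :: "('a \<Rightarrow> ereal) \<Rightarrow> 'a set" where
  "effective_domain F = {x. F x < \<infinity>}"

definition proper :: "('a \<Rightarrow> ereal) \<Rightarrow> bool" where
  "proper F \<longleftrightarrow> (\<forall>x. F x \<noteq> -\<infinity>) \<and> effective_domain F \<noteq> {}"

definition lower_semicontinuous :: "('a::topological_space \<Rightarrow> ereal) \<Rightarrow> bool" where
  "lower_semicontinuous F \<longleftrightarrow> (\<forall>x. F x \<le> Liminf (at x) F)"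

definition Prox :: "real \<Rightarrow> ('a::euclidean_space \<Rightarrow> ereal) \<Rightarrow> 'a \<Rightarrow> 'a set" where
  "Prox \<gamma> F x = {y. is_arg_min (\<lambda>y. F y + ereal (1 / (2 * \<gamma>) * (norm (y - x))\<^sup>2)) (\<lambda>_. True) y}"

definition frechet_subdifferential :: "('a::euclidean_space \<Rightarrow> ereal) \<Rightarrow> 'a \<Rightarrow> 'a set" where
  "frechet_subdifferential F x =
     {u. x \<in> effective_domain F \<and>
         Liminf (at x) (\<lambda>y. (F y - F x - ereal (inner u (y - x))) / ereal (norm (y - x))) \<ge> 0}"

definition limiting_subdifferential :: "('a::euclidean_space \<Rightarrow> ereal) \<Rightarrow> 'a \<Rightarrow> 'a set" where
  "limiting_subdifferential F x =
     {u. \<exists>X U. X \<longlonglongrightarrow> x \<and> (\<lambda>k. F (X k)) \<longlonglongrightarrow> F x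
           \<and> (\<forall>k. U k \<in> frechet_subdifferential F (X k)) \<and> U \<longlonglongrightarrow> u}"

text \<open>Unlike \<^const>\<open>infdist\<close>, the distance to the empty set is \<open>\<infinity>\<close>.\<close>

definition edist :: "'a::real_normed_vector \<Rightarrow> 'a set \<Rightarrow> ereal" where
  "edist x S = (INF y\<in>S. ereal (norm (y - x)))"

definition KL_property_at :: "('a::euclidean_space \<Rightarrow> ereal) \<Rightarrow> 'a \<Rightarrow> bool" where
  "KL_property_at F xs \<longleftrightarrow>
     (\<exists>(\<eta>::ereal) U (\<phi>::real \<Rightarrow> real) \<phi>'.
        0 < \<eta> \<and> open U \<and> xs \<in> U
        \<and> continuous_on {t. 0 \<le> t \<and> ereal t < \<eta>} \<phi>
        \<and> concave_on {t. 0 \<le> t \<and> ereal t < \<eta>} \<phi>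
        \<and> (\<forall>t. 0 \<le> t \<and> ereal t < \<eta> \<longrightarrow> 0 \<le> \<phi> t)
        \<and> \<phi> 0 = 0
        \<and> (\<forall>t. 0 < t \<and> ereal t < \<eta> \<longrightarrow> (\<phi> has_real_derivative \<phi>' t) (at t) \<and> 0 < \<phi>' t)
        \<and> continuous_on {t. 0 < t \<and> ereal t < \<eta>} \<phi>'
        \<and> (\<forall>x\<in>U. F xs < F x \<and> F x < F xs + \<eta> \<longrightarrow>
              ereal (\<phi>' (real_of_ereal (F x - F xs))) * edist 0 (limiting_subdifferential F x) \<ge> 1))"

definition KL_function :: "('a::euclidean_space \<Rightarrow> ereal) \<Rightarrow> bool" where
  "KL_function F \<longleftrightarrow> proper F \<and> lower_semicontinuous F
     \<and> (\<forall>x. limiting_subdifferential F x \<noteq> {} \<longrightarrow> KL_property_at F x)"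

definition Dop :: "('a::euclidean_space \<Rightarrow> real) \<Rightarrow> 'a \<Rightarrow> 'a" where
  "Dop g x = x - grad g x"

text \<open>When \<open>grad g\<close> is Lipschitz with constant \<open>< 1\<close>, \<open>Dop g\<close> is injective and
  \<^const>\<open>inv\<close> yields its inverse on the range.\<close>

definition phi :: "('a::euclidean_space \<Rightarrow> real) \<Rightarrow> 'a \<Rightarrow> ereal" where
  "phi g x = (if x \<in> range (Dop g)
     then ereal (g (inv (Dop g) x) - 1/2 * (norm (inv (Dop g) x - x))\<^sup>2) else \<infinity>)"

definition objective ::
  "('a::euclidean_space \<Rightarrow> real) \<Rightarrow> ('a \<Rightarrow> real) \<Rightarrow> ('a \<Rightarrow> real) \<Rightarrow> real \<Rightarrow> 'a \<Rightarrow> ereal" where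
  "objective f g h \<gamma> x = ereal (f x) + ereal (1 / \<gamma>) * phi g x + ereal (h x)"

definition merit_H ::
  "('a::euclidean_space \<Rightarrow> real) \<Rightarrow> ('a \<Rightarrow> real) \<Rightarrow> ('a \<Rightarrow> real) \<Rightarrow> real
     \<Rightarrow> 'a \<Rightarrow> 'a \<Rightarrow> 'a \<Rightarrow> ereal" where
  "merit_H f g h \<gamma> y z x =
     ereal (f y) + ereal (1 / \<gamma>) * phi g z + ereal (h y)
     + ereal (1 / (2 * \<gamma>) * (norm (y - x - \<gamma> *\<^sub>R grad h y))\<^sup>2)
     - ereal (1 / (2 * \<gamma>) * (norm (z - x - \<gamma> *\<^sub>R grad h y))\<^sup>2)"

definition merit_Theta ::
  "('a::euclidean_space \<Rightarrow> real) \<Rightarrow> ('a \<Rightarrow> real) \<Rightarrow> ('a \<Rightarrow> real) \<Rightarrow> real \<Rightarrow> real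
     \<Rightarrow> 'a \<times> 'a \<times> 'a \<times> 'a \<times> 'a \<Rightarrow> ereal" where
  "merit_Theta f g h \<alpha> \<gamma> = (\<lambda>(y, z, x, x1, x2).
     merit_H f g h \<gamma> y z x + ereal (\<alpha>\<^sup>2 / (2 * \<gamma>) * (norm (x1 - x2))\<^sup>2))"

text \<open>The sequence \<open>x\<close> starts at index \<open>-1\<close> and is therefore indexed by integers. The values
  \<open>x i\<close> for \<open>i < -1\<close>, \<open>y 0\<close> and \<open>z 0\<close> are unconstrained and not part of the iteration.\<close>

definition smooth_ePnP_DYS ::
  "('a::euclidean_space \<Rightarrow> real) \<Rightarrow> ('a \<Rightarrow> real) \<Rightarrow> ('a \<Rightarrow> real) \<Rightarrow> real \<Rightarrow> real
     \<Rightarrow> (nat \<Rightarrow> 'a) \<Rightarrow> (nat \<Rightarrow> 'a) \<Rightarrow> (nat \<Rightarrow> 'a) \<Rightarrow> (int \<Rightarrow> 'a) \<Rightarrow> bool" where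
  "smooth_ePnP_DYS f g h \<alpha> \<gamma> w y z x \<longleftrightarrow>
     x (-1) = x 0 \<and>
     (\<forall>k::nat.
        w k = x (int k) + \<alpha> *\<^sub>R (x (int k) - x (int k - 1)) \<and>
        y (k + 1) \<in> Prox \<gamma> (\<lambda>v. ereal (f v)) (w k) \<and>
        z (k + 1) = Dop g (2 *\<^sub>R y (k + 1) - \<gamma> *\<^sub>R grad h (y (k + 1)) - w k) \<and>
        x (int k + 1) = w k + (z (k + 1) - y (k + 1)))"

definition iterate :: "(nat \<Rightarrow> 'a) \<Rightarrow> (nat \<Rightarrow> 'a) \<Rightarrow> (int \<Rightarrow> 'a) \<Rightarrow> nat \<Rightarrow> 'a \<times> 'a \<times> 'a \<times> 'a \<times> 'a" where
  "iterate y z x k = (y k, z k, x (int k), x (int k - 1), x (int k - 2))"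

end

theory Submission
  imports Defs
begin

text \<open>Write \<open>G = \<nabla>f + \<nabla>h\<close>. As \<open>\<nabla>g\<close> is a contraction, \<open>D\<close> is bijective and \<open>phi\<close> is finite
  and differentiable with gradient \<open>D\<^sup>-\<^sup>1 - I\<close>. Along the iteration \<open>w = y + \<gamma>\<nabla>f(y)\<close> and
  \<open>z = D(y - \<gamma> G(y))\<close>, so the merit function \<open>H\<close> depends on \<open>y\<close> alone: it is the
  forward-backward envelope of the objective,
  \<open>E(y) = min\<^sub>u (f + h)(y) + \<langle>G(y), u - y\<rangle> + phi(u)/\<gamma> + |u - y|\<^sup>2/(2\<gamma>)\<close>.
  Comparing \<open>E\<close> at two consecutive points with the same \<open>u = z\<close> gives the sufficient decrease
  of \<open>\<Theta>\<close> in terms of \<open>|y\<^sup>k\<^sup>+\<^sup>1 - y\<^sup>k|\<^sup>2\<close>, whence square summability of all increments.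

  For the convergence of the whole sequence, \<open>E \<le> \<Phi>\<close> for the objective \<open>\<Phi>\<close>, and
  \<open>|\<nabla>\<Phi>(y)|\<close> is at most a multiple of \<open>|y - z|\<close>. Hence the KL inequality of \<open>\<Phi>\<close> bounds
  \<open>|y - z|\<close> from below in terms of \<open>E\<close>. The extrapolation term of \<open>\<Theta>\<close> is quadratic and is
  desingularized by a square root: \<open>\<phi>(t/2) + \<surd>t\<close> works for \<open>\<Theta>\<close>.\<close>

section \<open>Differentiable functions and subgradients\<close>

lemma GDERIV_along_line:
  fixes f :: "'a::real_inner \<Rightarrow> real"
  assumes "GDERIV f (x + t *\<^sub>R d) :> v"
  shows "((\<lambda>t. f (x + t *\<^sub>R d)) has_real_derivative d \<bullet> v) (at t)"
proof -
  have "((\<lambda>t. x + t *\<^sub>R d) has_derivative (\<lambda>s. s *\<^sub>R d)) (at t)"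
    by (auto intro!: derivative_eq_intros)
  then have "((\<lambda>t. f (x + t *\<^sub>R d)) has_derivative (\<lambda>s. (s *\<^sub>R d) \<bullet> v)) (at t)"
    using assms unfolding gderiv_def by (rule has_derivative_compose)
  then show ?thesis
    by (simp add: has_field_derivative_def mult.commute[of _ "d \<bullet> v"])
qed

lemma descent_lemma:
  fixes f :: "'a::euclidean_space \<Rightarrow> real"
  assumes diff: "\<And>v. f differentiable (at v)" and lip: "L-lipschitz_on UNIV (grad f)"
  shows "f y \<le> f x + (y - x) \<bullet> grad f x + L / 2 * (norm (y - x))\<^sup>2"
proof -
  define d where "d = y - x"
  \<comment> \<open>The restriction of \<open>f\<close> to the segment minus the claimed quadratic
    upper model: Cauchy-Schwarz and the Lipschitz bound make its derivative nonpositive on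
    [0, 1].\<close>
  define p where "p t = f (x + t *\<^sub>R d) - t * (d \<bullet> grad f x) - L / 2 * t\<^sup>2 * (norm d)\<^sup>2" for t
  have "p 1 \<le> p 0"
  proof (rule DERIV_nonpos_imp_nonincreasing[of 0 1 p])
    fix t :: real
    assume t: "0 \<le> t" "t \<le> 1"
    define D where "D = d \<bullet> grad f (x + t *\<^sub>R d) - d \<bullet> grad f x - L * t * (norm d)\<^sup>2"
    have "(p has_real_derivative D) (at t)"
      unfolding p_def D_def
      by (rule derivative_eq_intros GDERIV_along_line GDERIV_grad diff refl | simp)+
    moreover have "D \<le> 0"
    proof -
      have "d \<bullet> (grad f (x + t *\<^sub>R d) - grad f x) \<le> norm d * norm (grad f (x + t *\<^sub>R d) - grad f x)"
        by (rule norm_cauchy_schwarz)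
      also have "norm (grad f (x + t *\<^sub>R d) - grad f x) \<le> L * norm (t *\<^sub>R d)"
        using lipschitz_onD[OF lip, of "x + t *\<^sub>R d" x] by (simp add: dist_norm)
      finally have "d \<bullet> (grad f (x + t *\<^sub>R d) - grad f x) \<le> norm d * (L * norm (t *\<^sub>R d))"
        by (simp add: mult_left_mono)
      then show ?thesis
        using t by (simp add: D_def inner_diff_right power2_eq_square mult_ac)
    qed
    ultimately show "\<exists>D. (p has_real_derivative D) (at t) \<and> D \<le> 0" by blast
  qed simp
  then show ?thesis by (simp add: p_def d_def)
qed

text \<open>The convexified function lies above its tangent along the segment from \<open>x\<close>
  to \<open>y\<close>; the first-order terms of the added quadratic cancel and only its second-order
  term remains.\<close>

lemma weakly_convex_above_tangent:
  fixes f :: "'a::euclidean_space \<Rightarrow> real"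
  assumes diff: "\<And>v. f differentiable (at v)"
    and conv: "convex_on UNIV (\<lambda>v. f v + l / 2 * (norm v)\<^sup>2)"
  shows "f x + (y - x) \<bullet> grad f x - l / 2 * (norm (y - x))\<^sup>2 \<le> f y"
proof -
  define d where "d = y - x"
  define p where "p t = f (x + t *\<^sub>R d) + l / 2 * (norm (x + t *\<^sub>R d))\<^sup>2" for t
  have "convex_on UNIV p"
  proof (rule convex_onI)
    fix t a b :: real
    assume t: "0 < t" "t < 1"
    have eq: "x + ((1 - t) *\<^sub>R a + t *\<^sub>R b) *\<^sub>R d
        = (1 - t) *\<^sub>R (x + a *\<^sub>R d) + t *\<^sub>R (x + b *\<^sub>R d)"
      by (simp add: algebra_simps)
    show "p ((1 - t) *\<^sub>R a + t *\<^sub>R b) \<le> (1 - t) * p a + t * p b"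
      unfolding p_def eq using convex_onD[OF conv, of t "x + a *\<^sub>R d" "x + b *\<^sub>R d"] t by simp
  qed simp
  moreover have "(p has_real_derivative (d \<bullet> grad f x + l * (d \<bullet> x))) (at 0)"
    unfolding p_def power2_norm_eq_inner
    by (auto intro!: derivative_eq_intros GDERIV_along_line GDERIV_grad diff
        simp: inner_commute algebra_simps)
  ultimately have "(d \<bullet> grad f x + l * (d \<bullet> x)) * (1 - 0) \<le> p 1 - p 0"
    by (intro convex_on_imp_above_tangent[of UNIV]) auto
  moreover have "(norm (x + d))\<^sup>2 = (norm x)\<^sup>2 + 2 * (d \<bullet> x) + (norm d)\<^sup>2"
    by (simp add: power2_norm_eq_inner algebra_simps inner_commute)
  ultimately show ?thesis
    by (simp add: p_def flip: d_def) (simp add: d_def field_simps)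
qed

text \<open>Serves to differentiate the potential \<open>\<psi>\<close> of the denoiser, for which
  two-sided quadratic bounds are at hand without differentiating \<open>inv (Dop g)\<close>.\<close>

lemma GDERIV_I_quadratic:
  fixes f :: "'a::euclidean_space \<Rightarrow> real"
  assumes "\<And>u. \<bar>f u - f x - (u - x) \<bullet> v\<bar> \<le> C * (norm (u - x))\<^sup>2"
  shows "GDERIV f x :> v"
  unfolding gderiv_def has_derivative_at
proof (intro conjI)
  show "bounded_linear (\<lambda>h. h \<bullet> v)" by (rule bounded_linear_inner_left)
  show "(\<lambda>h. norm (f (x + h) - f x - h \<bullet> v) / norm h) \<midarrow>0\<rightarrow> 0"
  proof (rule Lim_null_comparison)
    show "\<forall>\<^sub>F h in at 0. norm (norm (f (x + h) - f x - h \<bullet> v) / norm h) \<le> C * norm h"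
    proof (rule always_eventually, rule allI)
      fix h
      show "norm (norm (f (x + h) - f x - h \<bullet> v) / norm h) \<le> C * norm h"
        using assms[of "x + h"] by (cases "h = 0") (auto simp: divide_simps power2_eq_square mult_ac)
    qed
    show "(\<lambda>h. C * norm h) \<midarrow>0\<rightarrow> 0" by (auto intro!: tendsto_eq_intros)
  qed
qed

text \<open>This inclusion serves two purposes: criticality asks for 0 as an element, and any
  element bounds the distance from 0 to the subdifferential from above.\<close>

lemma GDERIV_in_limiting_subdifferential:
  fixes f :: "'a::euclidean_space \<Rightarrow> real"
  assumes f: "GDERIV f x :> v"
  shows "v \<in> limiting_subdifferential (\<lambda>x. ereal (f x)) x"
proof -
  have "(\<lambda>y. norm (f y - f x - (y - x) \<bullet> v) / norm (y - x)) \<midarrow>x\<rightarrow> 0"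
    using f unfolding gderiv_def has_derivative_iff_norm by simp
  then have "(\<lambda>y. (f y - f x - v \<bullet> (y - x)) / norm (y - x)) \<midarrow>x\<rightarrow> 0"
    by (subst (asm) tendsto_rabs_zero_iff[symmetric], subst tendsto_rabs_zero_iff[symmetric])
      (simp add: inner_commute)
  then have "((\<lambda>y. ereal ((f y - f x - v \<bullet> (y - x)) / norm (y - x))) \<longlongrightarrow> ereal 0) (at x)"
    by simp
  moreover have "\<forall>\<^sub>F y in at x. ereal ((f y - f x - v \<bullet> (y - x)) / norm (y - x))
      = (ereal (f y) - ereal (f x) - ereal (v \<bullet> (y - x))) / ereal (norm (y - x))"
    by (auto simp: eventually_at intro!: exI[of _ 1])
  ultimately have "((\<lambda>y. (ereal (f y) - ereal (f x) - ereal (v \<bullet> (y - x))) / ereal (norm (y - x)))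
      \<longlongrightarrow> ereal 0) (at x)"
    by (rule Lim_transform_eventually)
  then have "v \<in> frechet_subdifferential (\<lambda>x. ereal (f x)) x"
    unfolding frechet_subdifferential_def effective_domain_def
    by (simp add: lim_imp_Liminf zero_ereal_def)
  then show ?thesis
    unfolding limiting_subdifferential_def
    by (intro CollectI exI[of _ "\<lambda>_. x"] exI[of _ "\<lambda>_. v"]) auto
qed

lemma Prox_stationary:
  fixes f :: "'a::euclidean_space \<Rightarrow> real"
  assumes diff: "f differentiable (at y)" and \<gamma>: "0 < \<gamma>"
    and y: "y \<in> Prox \<gamma> (\<lambda>v. ereal (f v)) w"
  shows "w = y + \<gamma> *\<^sub>R grad f y"
proof -
  define F where "F v = f v + 1 / (2 * \<gamma>) * (norm (v - w))\<^sup>2" for v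
  have min: "F y \<le> F v" for v
    using y unfolding Prox_def is_arg_min_def F_def by (simp add: not_less)
  define F' where "F' k = k \<bullet> (grad f y + (1 / \<gamma>) *\<^sub>R (y - w))" for k
  have "(F has_derivative F') (at y)"
    unfolding F_def F'_def power2_norm_eq_inner using GDERIV_grad[OF diff] \<gamma>
    by (auto intro!: derivative_eq_intros ext
        simp: gderiv_def inner_add_right inner_diff_right inner_commute field_simps)
  then have "F' = (\<lambda>v. 0)"
    using min by (intro differential_zero_maxmin[of y UNIV F F']) auto
  \<comment> \<open>At this argument the derivative is the squared norm of the gradient of
    \<open>F\<close>.\<close>
  then have "F' (grad f y + (1 / \<gamma>) *\<^sub>R (y - w)) = 0" by simp
  then have "grad f y + (1 / \<gamma>) *\<^sub>R (y - w) = 0" by (simp add: F'_def)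
  then have "\<gamma> *\<^sub>R (grad f y + (1 / \<gamma>) *\<^sub>R (y - w)) = 0" by simp
  then show ?thesis using \<gamma> by (simp add: scaleR_add_right algebra_simps)
qed

section \<open>Square-summable sequences\<close>

lemma summable_power2_add:
  fixes a b :: "nat \<Rightarrow> real"
  assumes "summable (\<lambda>k. (a k)\<^sup>2)" "summable (\<lambda>k. (b k)\<^sup>2)"
  shows "summable (\<lambda>k. (a k + b k)\<^sup>2)"
proof (rule summable_comparison_test')
  show "summable (\<lambda>k. 2 * ((a k)\<^sup>2 + (b k)\<^sup>2))"
    using assms by (intro summable_mult summable_add)
  show "norm ((a k + b k)\<^sup>2) \<le> 2 * ((a k)\<^sup>2 + (b k)\<^sup>2)" if "k \<ge> 0" for k
  proof -
    have "norm ((a k + b k)\<^sup>2) = (a k + b k)\<^sup>2" by simp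
    then show ?thesis using sum_squares_bound[of "a k" "b k"] by (simp only: power2_sum) simp
  qed
qed

lemma summable_power2_imp_tendsto_zero:
  fixes a :: "nat \<Rightarrow> real"
  assumes "summable (\<lambda>k. (a k)\<^sup>2)"
  shows "a \<longlonglongrightarrow> 0"
proof -
  have "(\<lambda>k. sqrt ((a k)\<^sup>2)) \<longlonglongrightarrow> sqrt 0"
    by (intro tendsto_real_sqrt summable_LIMSEQ_zero assms)
  then show ?thesis by (simp add: tendsto_rabs_zero_iff)
qed

text \<open>The squared minimum times the number of indices is at most the full sum.\<close>

lemma Min_bigo_of_summable_power2:
  fixes a :: "nat \<Rightarrow> real"
  assumes a: "\<And>k. 0 \<le> a k" and sum: "summable (\<lambda>k. (a k)\<^sup>2)"
  shows "(\<lambda>K. Min (a ` {m..K})) \<in> O(\<lambda>K. 1 / sqrt (real K))"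
proof (rule bigoI)
  define S where "S = (\<Sum>k. (a k)\<^sup>2)"
  show "\<forall>\<^sub>F K in sequentially. norm (Min (a ` {m..K})) \<le> sqrt (2 * S) * norm (1 / sqrt (real K))"
    \<comment> \<open>From here on \<open>{m..K}\<close> has at least \<open>K / 2\<close> elements,
      whence the factor 2 under the root.\<close>
    using eventually_ge_at_top[of "2 * m + 1"]
  proof eventually_elim
    case (elim K)
    let ?M = "Min (a ` {m..K})"
    have M: "?M \<in> a ` {m..K}" using elim by (intro Min_in) auto
    then have M0: "0 \<le> ?M" using a by auto
    have "real K / 2 * ?M\<^sup>2 \<le> real (card {m..K}) * ?M\<^sup>2"
      using elim by (intro mult_right_mono) auto
    also have "\<dots> = (\<Sum>k\<in>{m..K}. ?M\<^sup>2)" by simp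
    also have "\<dots> \<le> (\<Sum>k\<in>{m..K}. (a k)\<^sup>2)"
      by (intro sum_mono power_mono M0 Min_le) auto
    also have "\<dots> \<le> S" unfolding S_def by (intro sum_le_suminf sum) auto
    finally have "?M\<^sup>2 \<le> 2 * S / real K" using elim by (simp add: field_simps)
    then have "?M \<le> sqrt (2 * S / real K)" using M0 by (simp add: real_le_rsqrt)
    then show ?case using M0 by (simp add: real_sqrt_divide)
  qed
qed

text \<open>Telescoping. Applied to squares it yields square summability, applied to norms finite
  length.\<close>

lemma linear_recursion_sum_le:
  fixes a b :: "nat \<Rightarrow> real"
  assumes a: "\<And>k. 0 \<le> a k" and rec: "\<And>k. k < n \<Longrightarrow> a (Suc k) \<le> r * a k + B * b k"
  shows "(1 - r) * (\<Sum>k<n. a k) \<le> a 0 + B * (\<Sum>k<n. b k)"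
proof -
  have "(1 - r) * (\<Sum>k<m. a k) \<le> a 0 - a m + B * (\<Sum>k<m. b k)" if "m \<le> n" for m
    using that
  proof (induction m)
    case (Suc m)
    then show ?case using rec[of m] by (simp add: algebra_simps)
  qed simp
  from this[of n] a[of n] show ?thesis by simp
qed

lemma linear_recursion_summable_power2:
  fixes a b :: "nat \<Rightarrow> real"
  assumes a: "\<And>k. 0 \<le> a k" and r: "0 \<le> r" "r < 1"
    and rec: "\<And>k. a (Suc k) \<le> r * a k + B * b k" and sum: "summable (\<lambda>k. (b k)\<^sup>2)"
  shows "summable (\<lambda>k. (a k)\<^sup>2)"
proof (rule bounded_imp_summable)
  \<comment> \<open>Convexity of the square produces this constant when
    \<open>r * a k + B * b k\<close> is read as the average of \<open>a k\<close> and
    \<open>B * b k / (1 - r)\<close> with weights \<open>r\<close> and \<open>1 - r\<close>.\<close>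
  define C where "C = B\<^sup>2 / (1 - r)"
  have step: "(a (Suc k))\<^sup>2 \<le> r * (a k)\<^sup>2 + C * (b k)\<^sup>2" for k
  proof -
    have "(a (Suc k))\<^sup>2 \<le> (r * a k + B * b k)\<^sup>2"
      using rec a by (intro power_mono) auto
    moreover have "(1 - r) * (r * (a k)\<^sup>2 + C * (b k)\<^sup>2 - (r * a k + B * b k)\<^sup>2)
        = r * ((1 - r) * a k - B * b k)\<^sup>2"
    proof -
      have "(1 - r) * C = B\<^sup>2" using r by (simp add: C_def)
      then show ?thesis by algebra
    qed
    then have "0 \<le> (1 - r) * (r * (a k)\<^sup>2 + C * (b k)\<^sup>2 - (r * a k + B * b k)\<^sup>2)"
      using r by simp
    then have "0 \<le> r * (a k)\<^sup>2 + C * (b k)\<^sup>2 - (r * a k + B * b k)\<^sup>2"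
      using r by (simp add: zero_le_mult_iff)
    ultimately show ?thesis by linarith
  qed
  fix n
  have "(1 - r) * (\<Sum>k<Suc n. (a k)\<^sup>2) \<le> (a 0)\<^sup>2 + C * (\<Sum>k<Suc n. (b k)\<^sup>2)"
    by (rule linear_recursion_sum_le) (use step in auto)
  also have "\<dots> \<le> (a 0)\<^sup>2 + C * (\<Sum>k. (b k)\<^sup>2)"
    using r by (intro add_left_mono mult_left_mono sum_le_suminf sum) (auto simp: C_def)
  finally show "(\<Sum>k\<le>n. (a k)\<^sup>2) \<le> ((a 0)\<^sup>2 + C * (\<Sum>k. (b k)\<^sup>2)) / (1 - r)"
    using r by (simp add: field_simps lessThan_Suc_atMost)
qed simp

lemma convergent_if_summable_diff:
  fixes u :: "nat \<Rightarrow> 'a::banach"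
  assumes "summable (\<lambda>k. norm (u (Suc k) - u k))"
  shows "convergent u"
proof -
  have "convergent (\<lambda>n. \<Sum>k<n. u (Suc k) - u k)"
    using summable_norm_cancel[OF assms] by (simp add: summable_iff_convergent)
  then have "convergent (\<lambda>n. (u n - u 0) + u 0)"
    by (intro convergent_add convergent_const) (simp add: sum_lessThan_telescope)
  then show ?thesis by simp
qed

section \<open>The denoiser as a proximal operator\<close>

locale gradient_step_denoiser =
  fixes g :: "'a::euclidean_space \<Rightarrow> real" and L :: real
  assumes g_diff: "g differentiable (at v)"
    and g_lip: "L-lipschitz_on UNIV (grad g)" and L_less_1: "L < 1"
begin

abbreviation "D \<equiv> Dop g"
abbreviation "Dinv \<equiv> inv (Dop g)"

text \<open>Real-valued form of \<open>phi g\<close>: the value infinity does not occur because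
  \<open>D\<close> is surjective.\<close>

definition \<psi> :: "'a \<Rightarrow> real" where
  "\<psi> x = g (Dinv x) - 1/2 * (norm (Dinv x - x))\<^sup>2"

lemma L_nonneg: "0 \<le> L"
  using g_lip by (rule lipschitz_on_nonneg)

lemma norm_grad_g: "norm (grad g x - grad g y) \<le> L * norm (x - y)"
  using lipschitz_onD[OF g_lip, of x y] by (simp add: dist_norm)

lemma norm_Dop: "(1 - L) * norm (x - y) \<le> norm (D x - D y)"
proof -
  have "norm (x - y) = norm ((D x - D y) + (grad g x - grad g y))" by (simp add: Dop_def)
  also have "\<dots> \<le> norm (D x - D y) + norm (grad g x - grad g y)" by (rule norm_triangle_ineq)
  also have "\<dots> \<le> norm (D x - D y) + L * norm (x - y)" using norm_grad_g by simp
  finally show ?thesis by (simp add: algebra_simps)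
qed

lemma inj_Dop: "inj D"
proof (rule injI)
  fix x y assume "D x = D y"
  with norm_Dop[of x y] L_less_1 show "x = y" by (simp add: mult_le_0_iff)
qed

text \<open>Solving \<open>D t = x\<close> amounts to finding a fixed point of the contraction that
  maps \<open>t\<close> to \<open>x + grad g t\<close>.\<close>

lemma surj_Dop: "surj D"
  unfolding surj_def
proof
  fix x :: 'a
  have "\<exists>!t\<in>UNIV. x + grad g t = t"
  proof (rule Banach_fix)
    show "dist (x + grad g s) (x + grad g t) \<le> L * dist s t" for s t
      using norm_grad_g by (simp add: dist_norm)
  qed (use L_nonneg L_less_1 in \<open>auto intro: complete_UNIV\<close>)
  then obtain t where "x + grad g t = t" by auto
  then have "x = D t" by (simp add: Dop_def algebra_simps)
  then show "\<exists>t. x = D t" ..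
qed

lemma Dinv_D [simp]: "Dinv (D x) = x"
  using inj_Dop by simp

lemma D_Dinv [simp]: "D (Dinv x) = x"
  using surj_Dop by (rule surj_f_inv_f)

lemma norm_Dinv: "norm (Dinv x - Dinv y) \<le> norm (x - y) / (1 - L)"
  using norm_Dop[of "Dinv x" "Dinv y"] L_less_1 by (simp add: field_simps)

lemma phi_eq: "phi g x = ereal (\<psi> x)"
  using surj_Dop by (simp add: phi_def \<psi>_def)

lemma \<psi>_D: "\<psi> (D x) = g x - 1/2 * (norm (D x - x))\<^sup>2"
  by (simp add: \<psi>_def norm_minus_commute)

lemma grad_g_eq: "grad g (Dinv x) = Dinv x - x"
  using D_Dinv[of x] unfolding Dop_def by (simp add: algebra_simps)

text \<open>\<open>g\<close> is the Moreau envelope of \<open>\<psi>\<close>, with equality at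
  \<open>x = D s\<close>. In the descent inequality of \<open>g\<close> at \<open>Dinv x\<close>,
  enlarging \<open>L\<close> to 1 lets the quadratic complete to a square.\<close>

lemma prox_inequality: "g s \<le> \<psi> x + 1/2 * (norm (x - s))\<^sup>2"
proof -
  define t where "t = Dinv x"
  have "g s \<le> g t + (s - t) \<bullet> (t - x) + L / 2 * (norm (s - t))\<^sup>2"
    using descent_lemma[OF g_diff g_lip, of s t] grad_g_eq[of x] by (simp add: t_def)
  also have "\<dots> \<le> g t + (s - t) \<bullet> (t - x) + 1 / 2 * (norm (s - t))\<^sup>2"
    using L_less_1 by (intro add_left_mono mult_right_mono) auto
  also have "\<dots> = \<psi> x + 1/2 * (norm (x - s))\<^sup>2"
    unfolding \<psi>_def t_def[symmetric] power2_norm_eq_inner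
    by (simp add: inner_add_left inner_add_right inner_diff_left inner_diff_right inner_commute
        field_simps)
  finally show ?thesis .
qed

text \<open>Optimality of \<open>x\<close> in the proximal problem centred at \<open>Dinv x\<close>,
  with the squares expanded; equivalently, \<open>Dinv x\<close> is a subgradient of \<psi> + |.|^2
  / 2 at \<open>x\<close>.\<close>

lemma \<psi>_lower_quadratic: "\<psi> x + (u - x) \<bullet> (Dinv x - x) - 1/2 * (norm (u - x))\<^sup>2 \<le> \<psi> u"
proof -
  have "\<psi> x + 1/2 * (norm (Dinv x - x))\<^sup>2 \<le> \<psi> u + 1/2 * (norm (u - Dinv x))\<^sup>2"
    using prox_inequality[of "Dinv x" u] by (simp add: \<psi>_def)
  then show ?thesis
    unfolding power2_norm_eq_inner
    by (simp add: inner_add_left inner_add_right inner_diff_left inner_diff_right inner_commute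
        field_simps)
qed

text \<open>\<open>\<psi>_lower_quadratic\<close> bounds the remainder from below; with
  \<open>u\<close> and \<open>x\<close> exchanged, and with the Lipschitz bound for
  \<open>Dinv\<close>, it bounds the remainder from above.\<close>

lemma GDERIV_\<psi>: "GDERIV \<psi> x :> Dinv x - x"
proof (rule GDERIV_I_quadratic)
  fix u
  have "\<psi> u - \<psi> x - (u - x) \<bullet> (Dinv x - x)
      \<le> (u - x) \<bullet> ((Dinv u - Dinv x) - (u - x)) + 1/2 * (norm (u - x))\<^sup>2"
    using \<psi>_lower_quadratic[of u x]
    by (simp add: inner_diff_left inner_diff_right norm_minus_commute)
  also have "\<dots> \<le> (u - x) \<bullet> (Dinv u - Dinv x)"
    by (simp add: inner_diff_right[of _ "Dinv u - Dinv x"] flip: power2_norm_eq_inner)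
  also have "\<dots> \<le> norm (u - x) * norm (Dinv u - Dinv x)" by (rule norm_cauchy_schwarz)
  also have "\<dots> \<le> norm (u - x) * (norm (u - x) / (1 - L))"
    by (intro mult_left_mono norm_Dinv) simp
  also have "\<dots> = 1 / (1 - L) * (norm (u - x))\<^sup>2" by (simp add: power2_eq_square)
  finally have "\<psi> u - \<psi> x - (u - x) \<bullet> (Dinv x - x) \<le> 1 / (1 - L) * (norm (u - x))\<^sup>2" .
  moreover have "- (1 / (1 - L) * (norm (u - x))\<^sup>2) \<le> - (1/2 * (norm (u - x))\<^sup>2)"
    using L_less_1 L_nonneg by (intro le_imp_neg_le mult_right_mono) (auto simp: field_simps)
  ultimately show "\<bar>\<psi> u - \<psi> x - (u - x) \<bullet> (Dinv x - x)\<bar> \<le> 1 / (1 - L) * (norm (u - x))\<^sup>2"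
    using \<psi>_lower_quadratic[of x u] by linarith
qed

end

section \<open>Sufficient decrease of the merit function\<close>

text \<open>Controls the vector that is paired with the gradient increment of \<open>h\<close>. In
  each case the right side minus the left is a sum of visibly nonnegative terms.\<close>

lemma power2_norm_diff_scaleR_le:
  fixes u v d :: "'a::real_inner"
  assumes \<alpha>: "0 \<le> \<alpha>" and "\<alpha> \<le> 1/2 \<or> \<alpha> \<le> 3/4 \<and> 0 \<le> u \<bullet> d"
  shows "(norm (u - \<alpha> *\<^sub>R (d + v)))\<^sup>2
    \<le> (norm u)\<^sup>2 + \<alpha> * (norm d)\<^sup>2 + (norm (v - u))\<^sup>2 + 2 * \<alpha> * (norm v)\<^sup>2" (is "?l \<le> ?r")
  using assms(2)
proof
  assume "\<alpha> \<le> 1/2"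
  have "?r - ?l = (norm (v - u - \<alpha> *\<^sub>R (d + v)))\<^sup>2
      + \<alpha> * (1 - 2 * \<alpha>) * (norm (d + v))\<^sup>2 + 3 * \<alpha> * (norm v)\<^sup>2"
    unfolding power2_norm_eq_inner
    by (simp add: inner_add_left inner_add_right inner_diff_left inner_diff_right inner_commute) algebra
  also have "0 \<le> \<dots>" using \<alpha> \<open>\<alpha> \<le> 1/2\<close> by (intro add_nonneg_nonneg mult_nonneg_nonneg) auto
  finally show ?thesis by linarith
next
  assume *: "\<alpha> \<le> 3/4 \<and> 0 \<le> u \<bullet> d"
  have "?r - ?l = 2 * \<alpha> * (u \<bullet> d) + (1 - \<alpha>) * (norm (v - u))\<^sup>2 + \<alpha> * (norm u)\<^sup>2
      + \<alpha> / 4 * (norm (d - 3 *\<^sub>R v))\<^sup>2 + \<alpha> * (3/4 - \<alpha>) * (norm (d + v))\<^sup>2"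
    unfolding power2_norm_eq_inner
    by (simp add: inner_add_left inner_add_right inner_diff_left inner_diff_right inner_commute
        field_simps)
  also have "0 \<le> \<dots>" using \<alpha> * by (intro add_nonneg_nonneg mult_nonneg_nonneg) auto
  finally show ?thesis by linarith
qed

text \<open>In its use \<open>d\<close> is the increment of \<open>y\<close>, \<open>u\<close> and
  \<open>t\<close> are \<gamma> times those of \<open>grad f\<close> and \<open>grad h\<close>,
  \<open>q\<close> is the new increment of \<open>x\<close>, and the vector in the last norm is
  \<alpha> times the previous one.\<close>

lemma extrapolated_step_bound:
  fixes d u t q :: "'a::real_inner"
  assumes \<alpha>: "0 \<le> \<alpha>" and cases: "\<alpha> \<le> 1/2 \<or> \<alpha> \<le> 3/4 \<and> 0 \<le> u \<bullet> d"
    and u: "norm u \<le> a * norm d" and t: "norm t \<le> b * norm d" and b: "0 \<le> b" "b \<le> 1"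
  shows "(u - d) \<bullet> (d + u - \<alpha> *\<^sub>R q) + t \<bullet> (u - \<alpha> *\<^sub>R q)
      + (norm (\<alpha> *\<^sub>R q))\<^sup>2 / 2 - (norm ((1 + \<alpha>) *\<^sub>R q - d - u))\<^sup>2 / 2
    \<le> (\<alpha> + a\<^sup>2 - 1 + b / 2 * (1 + a\<^sup>2 + \<alpha>)) * (norm d)\<^sup>2" (is "?l \<le> _")
proof -
  \<comment> \<open>With \<open>q = d + v\<close> the left side contains -|v - u|^2 / 2 and
    -\<alpha> |v|^2, which absorb the excess from Young's inequality below.\<close>
  define v where "v = q - d"
  define X where "X = u - \<alpha> *\<^sub>R (d + v)"
  have q: "q = d + v" by (simp add: v_def)
  have u2: "(norm u)\<^sup>2 \<le> a\<^sup>2 * (norm d)\<^sup>2"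
    using power_mono[OF u, of 2] by (simp add: power_mult_distrib)
  have "?l = (norm u)\<^sup>2 - (norm d)\<^sup>2 + \<alpha> * (norm d)\<^sup>2 + t \<bullet> X
      - (norm (v - u))\<^sup>2 / 2 - \<alpha> * (norm v)\<^sup>2"
    unfolding power2_norm_eq_inner X_def q
    by (simp add: inner_add_left inner_add_right inner_diff_left inner_diff_right inner_commute
        field_simps)
  moreover have "t \<bullet> X \<le> b / 2 * ((norm d)\<^sup>2 + (norm X)\<^sup>2)"
  proof -
    have "t \<bullet> X \<le> norm t * norm X" by (rule norm_cauchy_schwarz)
    also have "\<dots> \<le> b * norm d * norm X" using t by (rule mult_right_mono) simp
    also have "\<dots> = b / 2 * (2 * norm d * norm X)" by simp
    also have "\<dots> \<le> b / 2 * ((norm d)\<^sup>2 + (norm X)\<^sup>2)"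
      using b by (intro mult_left_mono sum_squares_bound) auto
    finally show ?thesis .
  qed
  moreover have "b / 2 * (norm X)\<^sup>2
      \<le> b / 2 * ((a\<^sup>2 + \<alpha>) * (norm d)\<^sup>2) + (norm (v - u))\<^sup>2 / 2 + \<alpha> * (norm v)\<^sup>2"
  proof -
    have "(norm X)\<^sup>2 \<le> (norm u)\<^sup>2 + \<alpha> * (norm d)\<^sup>2 + (norm (v - u))\<^sup>2 + 2 * \<alpha> * (norm v)\<^sup>2"
      unfolding X_def using \<alpha> cases by (rule power2_norm_diff_scaleR_le)
    also have "\<dots> \<le> (a\<^sup>2 + \<alpha>) * (norm d)\<^sup>2 + ((norm (v - u))\<^sup>2 + 2 * \<alpha> * (norm v)\<^sup>2)"
      using u2 by (simp add: algebra_simps)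
    finally have "b / 2 * (norm X)\<^sup>2
        \<le> b / 2 * ((a\<^sup>2 + \<alpha>) * (norm d)\<^sup>2 + ((norm (v - u))\<^sup>2 + 2 * \<alpha> * (norm v)\<^sup>2))"
      using b by (intro mult_left_mono) auto
    \<comment> \<open>Here \<open>b \<le> 1\<close> enters: the excess does not exceed the two
      negative squares.\<close>
    moreover have "b / 2 * ((norm (v - u))\<^sup>2 + 2 * \<alpha> * (norm v)\<^sup>2)
        \<le> 1 / 2 * ((norm (v - u))\<^sup>2 + 2 * \<alpha> * (norm v)\<^sup>2)"
      using b \<alpha> by (intro mult_right_mono) auto
    ultimately show ?thesis by (simp add: algebra_simps)
  qed
  ultimately show ?thesis using u2 by (simp add: algebra_simps)
qed

section \<open>Standing assumptions and the forward-backward envelope\<close>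

locale pnp_dys = gradient_step_denoiser g L
  for g :: "'a::euclidean_space \<Rightarrow> real" and L +
  fixes f h :: "'a \<Rightarrow> real"
    and L\<^sub>f L\<^sub>h l\<^sub>f \<alpha> \<gamma> :: real
    and w y z :: "nat \<Rightarrow> 'a" and x :: "int \<Rightarrow> 'a"
  assumes f_diff: "f differentiable (at v)" and f_lip: "L\<^sub>f-lipschitz_on UNIV (grad f)"
    and h_diff: "h differentiable (at v)" and h_lip: "L\<^sub>h-lipschitz_on UNIV (grad h)"
    and f_weakly_convex: "convex_on UNIV (\<lambda>v. f v + l\<^sub>f / 2 * (norm v)\<^sup>2)"
    and bounded_below: "bdd_below (range f)" "bdd_below (range g)" "bdd_below (range h)"
    and \<gamma>_pos: "0 < \<gamma>" and \<gamma>_less: "\<gamma> * (L\<^sub>f + L\<^sub>h) < 1"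
    and \<alpha>_nonneg: "0 \<le> \<alpha>"
    and \<alpha>_less: "\<alpha> < (1 - \<gamma> * l\<^sub>f - 2 * \<gamma> * L\<^sub>h) / (2 + \<gamma> * L\<^sub>h) - \<gamma>\<^sup>2 * L\<^sub>f\<^sup>2"
    and iteration: "smooth_ePnP_DYS f g h \<alpha> \<gamma> w y z x"
    and bounded_iterates: "bounded ((\<lambda>k. (y k, z k, x (int k))) ` {1..})"
begin

definition G :: "'a \<Rightarrow> 'a" where
  "G v = grad f v + grad h v"

text \<open>The minimum over \<open>u\<close> in closed form: completing the square around the
  forward point \<open>v - \<gamma> *\<^sub>R G v\<close> leaves the Moreau envelope
  \<open>g\<close> evaluated there.\<close>

definition envelope :: "'a \<Rightarrow> real" where
  "envelope v = f v + h v + g (v - \<gamma> *\<^sub>R G v) / \<gamma> - \<gamma> / 2 * (norm (G v))\<^sup>2"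

definition \<Phi> :: "'a \<Rightarrow> real" where
  "\<Phi> v = f v + \<psi> v / \<gamma> + h v"

lemma L\<^sub>f_nonneg: "0 \<le> L\<^sub>f"
  using f_lip by (rule lipschitz_on_nonneg)

lemma L\<^sub>h_nonneg: "0 \<le> L\<^sub>h"
  using h_lip by (rule lipschitz_on_nonneg)

lemma objective_eq: "objective f g h \<gamma> = (\<lambda>v. ereal (\<Phi> v))"
  by (simp add: fun_eq_iff objective_def phi_eq \<Phi>_def)

lemma GDERIV_\<Phi>: "GDERIV \<Phi> v :> (1 / \<gamma>) *\<^sub>R (Dinv v - (v - \<gamma> *\<^sub>R G v))"
proof -
  have "GDERIV \<Phi> v :> grad f v + (1 / \<gamma>) *\<^sub>R (Dinv v - v) + grad h v"
    using GDERIV_grad[OF f_diff, of v] GDERIV_grad[OF h_diff, of v] GDERIV_\<psi>[of v] \<gamma>_pos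
    unfolding \<Phi>_def gderiv_def
    by (auto intro!: derivative_eq_intros ext simp: inner_add_right)
  moreover have "grad f v + (1 / \<gamma>) *\<^sub>R (Dinv v - v) + grad h v
      = (1 / \<gamma>) *\<^sub>R (Dinv v - (v - \<gamma> *\<^sub>R G v))"
    using \<gamma>_pos by (simp add: G_def algebra_simps)
  ultimately show ?thesis by simp
qed

text \<open>Completing the square around \<open>s\<close> reduces both claims to
  \<open>prox_inequality\<close> and its equality case \<open>\<psi>_D\<close>.\<close>

lemma envelope_le: "envelope v \<le> f v + h v + (u - v) \<bullet> G v + \<psi> u / \<gamma> + (norm (u - v))\<^sup>2 / (2 * \<gamma>)"
  and envelope_eq: "u = D (v - \<gamma> *\<^sub>R G v) \<Longrightarrow>
    envelope v = f v + h v + (u - v) \<bullet> G v + \<psi> u / \<gamma> + (norm (u - v))\<^sup>2 / (2 * \<gamma>)"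
proof -
  define s where "s = v - \<gamma> *\<^sub>R G v"
  have *: "(norm (u - s))\<^sup>2 / (2 * \<gamma>) = (norm (u - v))\<^sup>2 / (2 * \<gamma>) + (u - v) \<bullet> G v + \<gamma> / 2 * (norm (G v))\<^sup>2"
    for u
    using \<gamma>_pos unfolding s_def power2_norm_eq_inner
    by (simp add: inner_add_left inner_add_right inner_diff_left inner_diff_right inner_commute
        field_simps)
  have "g s / \<gamma> \<le> \<psi> u / \<gamma> + (norm (u - s))\<^sup>2 / (2 * \<gamma>)"
    using divide_right_mono[OF prox_inequality[of s u], of \<gamma>] \<gamma>_pos by (simp add: add_divide_distrib)
  then show "envelope v \<le> f v + h v + (u - v) \<bullet> G v + \<psi> u / \<gamma> + (norm (u - v))\<^sup>2 / (2 * \<gamma>)"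
    unfolding envelope_def s_def[symmetric] * by simp
  assume "u = D (v - \<gamma> *\<^sub>R G v)"
  then have "\<psi> u = g s - 1/2 * (norm (u - s))\<^sup>2" using \<psi>_D[of s] by (simp add: s_def)
  then have "g s / \<gamma> = \<psi> u / \<gamma> + (norm (u - s))\<^sup>2 / (2 * \<gamma>)"
    using \<gamma>_pos by (simp add: field_simps)
  then show "envelope v = f v + h v + (u - v) \<bullet> G v + \<psi> u / \<gamma> + (norm (u - v))\<^sup>2 / (2 * \<gamma>)"
    unfolding envelope_def s_def[symmetric] * by simp
qed

lemma envelope_le_\<Phi>: "envelope v \<le> \<Phi> v"
  using envelope_le[of v v] by (simp add: \<Phi>_def)

lemma envelope_eq_\<Phi>: "v = D (v - \<gamma> *\<^sub>R G v) \<Longrightarrow> envelope v = \<Phi> v"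
  using envelope_eq[of v v] by (simp add: \<Phi>_def)

text \<open>As \<open>\<gamma> * (L\<^sub>f + L\<^sub>h) < 1\<close>, moving from \<open>v\<close>
  to the forward point lowers \<open>f + h\<close> by at least \<gamma> / 2 |G v|^2, which pays for
  the negative term of the envelope.\<close>

lemma envelope_bounded_below: obtains B where "\<And>v. B \<le> envelope v"
proof -
  obtain bf bg bh where b: "\<And>v. bf \<le> f v" "\<And>v. bg \<le> g v" "\<And>v. bh \<le> h v"
    using bounded_below unfolding bdd_below_def by auto
  have "bf + bh + bg / \<gamma> \<le> envelope v" for v
  proof -
    let ?s = "v - \<gamma> *\<^sub>R G v"
    have "bf + bh \<le> f ?s + h ?s" using b by (intro add_mono)
    also have "\<dots> \<le> f v + h v - \<gamma> * (norm (G v))\<^sup>2 + (L\<^sub>f + L\<^sub>h) / 2 * (norm (\<gamma> *\<^sub>R G v))\<^sup>2"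
    proof -
      have s: "?s - v = - (\<gamma> *\<^sub>R G v)" by simp
      have "(- (\<gamma> *\<^sub>R G v)) \<bullet> grad f v + (- (\<gamma> *\<^sub>R G v)) \<bullet> grad h v = - \<gamma> * (norm (G v))\<^sup>2"
        by (simp add: power2_norm_eq_inner G_def inner_add_right[of "_ + _"] distrib_left)
      then show ?thesis
        using descent_lemma[OF f_diff f_lip, of ?s v] descent_lemma[OF h_diff h_lip, of ?s v]
        unfolding s by (simp only: norm_minus_cancel add_divide_distrib distrib_right)
    qed
    also have "(L\<^sub>f + L\<^sub>h) / 2 * (norm (\<gamma> *\<^sub>R G v))\<^sup>2 = \<gamma> * (L\<^sub>f + L\<^sub>h) * (\<gamma> / 2 * (norm (G v))\<^sup>2)"
      by (simp add: power_mult_distrib power2_eq_square)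
    also have "\<dots> \<le> 1 * (\<gamma> / 2 * (norm (G v))\<^sup>2)"
      using \<gamma>_less \<gamma>_pos by (intro mult_right_mono) auto
    finally have "bf + bh \<le> f v + h v - \<gamma> / 2 * (norm (G v))\<^sup>2" by simp
    moreover have "bg / \<gamma> \<le> g ?s / \<gamma>" using b \<gamma>_pos by (simp add: divide_right_mono)
    ultimately show ?thesis by (simp add: envelope_def)
  qed
  then show ?thesis by (rule that)
qed

lemma continuous_G: "continuous_on UNIV G"
  unfolding G_def
  by (intro continuous_intros lipschitz_on_continuous_on[OF f_lip] lipschitz_on_continuous_on[OF h_lip])

lemma continuous_D: "continuous_on UNIV D"
  unfolding Dop_def by (intro continuous_intros lipschitz_on_continuous_on[OF g_lip])

lemma continuous_fgh: "continuous_on UNIV f" "continuous_on UNIV g" "continuous_on UNIV h"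
  using f_diff g_diff h_diff
  by (auto intro!: continuous_at_imp_continuous_on differentiable_imp_continuous_within)

lemma continuous_envelope: "continuous_on UNIV envelope"
  unfolding envelope_def
  by (intro continuous_intros continuous_G continuous_fgh
      continuous_on_compose2[OF continuous_fgh(2)]) (use \<gamma>_pos in auto)

section \<open>One step of the iteration and the value of the merit function\<close>

definition q :: "nat \<Rightarrow> 'a" where
  "q k = x (int k) - x (int k - 1)"

lemma iteration_facts:
  shows w_eq: "w k = x (int k) + \<alpha> *\<^sub>R q k"
    and w_y: "w k = y (Suc k) + \<gamma> *\<^sub>R grad f (y (Suc k))"
    and z_eq: "z (Suc k) = D (y (Suc k) - \<gamma> *\<^sub>R G (y (Suc k)))"
    and x_eq: "x (int (Suc k)) = w k + (z (Suc k) - y (Suc k))"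
proof -
  have it: "w k = x (int k) + \<alpha> *\<^sub>R (x (int k) - x (int k - 1))"
    "y (k + 1) \<in> Prox \<gamma> (\<lambda>v. ereal (f v)) (w k)"
    "z (k + 1) = Dop g (2 *\<^sub>R y (k + 1) - \<gamma> *\<^sub>R grad h (y (k + 1)) - w k)"
    "x (int k + 1) = w k + (z (k + 1) - y (k + 1))"
    using iteration unfolding smooth_ePnP_DYS_def by blast+
  show "w k = x (int k) + \<alpha> *\<^sub>R q k" using it by (simp add: q_def)
  show w: "w k = y (Suc k) + \<gamma> *\<^sub>R grad f (y (Suc k))"
    using Prox_stationary[OF f_diff \<gamma>_pos it(2)] by simp
  have "2 *\<^sub>R y (k + 1) - \<gamma> *\<^sub>R grad h (y (k + 1)) - w k = y (Suc k) - \<gamma> *\<^sub>R G (y (Suc k))"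
    unfolding w by (simp add: G_def scaleR_2 algebra_simps)
  then show "z (Suc k) = D (y (Suc k) - \<gamma> *\<^sub>R G (y (Suc k)))" using it(3) by simp
  show "x (int (Suc k)) = w k + (z (Suc k) - y (Suc k))" using it(4) by (simp add: add.commute)
qed

lemma q_0: "q 0 = 0"
  using iteration by (simp add: q_def smooth_ePnP_DYS_def)

lemma z_minus_y: "z (Suc k) - y (Suc k) = q (Suc k) - \<alpha> *\<^sub>R q k"
  using x_eq[of k] w_eq[of k] by (simp add: q_def)

text \<open>The merit value at index \<open>k + 1\<close>, since the iteration determines
  \<open>y\<close> and \<open>z\<close> only from index 1 on; the last two entries of the iterate
  there differ by \<open>q k\<close>.\<close>

definition \<Theta> :: "nat \<Rightarrow> real" where
  "\<Theta> k = envelope (y (Suc k)) + (norm (\<alpha> *\<^sub>R q k))\<^sup>2 / (2 * \<gamma>)"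

text \<open>With \<open>x\<close> eliminated, the two residuals in \<open>merit_H\<close> are
  \<open>s - D s\<close> and \<open>- \<gamma> *\<^sub>R G v\<close>; the square of the first
  cancels the one inside \<open>\<psi> (D s)\<close>.\<close>

lemma merit_Theta_eq: "merit_Theta f g h \<alpha> \<gamma> (iterate y z x (Suc k)) = ereal (\<Theta> k)"
proof -
  define v where "v = y (Suc k)"
  define s where "s = v - \<gamma> *\<^sub>R G v"
  have z: "z (Suc k) = D s" using z_eq by (simp add: s_def v_def)
  have x: "x (int (Suc k)) = v + \<gamma> *\<^sub>R grad f v + (D s - v)"
    using x_eq[of k] w_y[of k] by (simp add: z v_def)
  have 1: "v - x (int (Suc k)) - \<gamma> *\<^sub>R grad h v = s - D s"
    unfolding x by (simp add: s_def G_def algebra_simps)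
  have 2: "D s - x (int (Suc k)) - \<gamma> *\<^sub>R grad h v = - \<gamma> *\<^sub>R G v"
    unfolding x by (simp add: G_def algebra_simps)
  have "merit_H f g h \<gamma> v (D s) (x (int (Suc k)))
      = ereal (f v + 1 / \<gamma> * \<psi> (D s) + h v + 1 / (2 * \<gamma>) * (norm (s - D s))\<^sup>2
          - 1 / (2 * \<gamma>) * (norm (- \<gamma> *\<^sub>R G v))\<^sup>2)"
    unfolding merit_H_def phi_eq 1 2 by simp
  also have "\<dots> = ereal (envelope v)"
    using \<gamma>_pos unfolding envelope_def \<psi>_D s_def[symmetric]
    by (simp add: norm_minus_commute power_mult_distrib field_simps power2_eq_square)
  finally have "merit_H f g h \<gamma> v (D s) (x (int (Suc k))) = ereal (envelope v)" .
  then show ?thesis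
    unfolding merit_Theta_def iterate_def \<Theta>_def
    by (simp add: z q_def power_mult_distrib flip: v_def)
qed

section \<open>Decrease of the merit function along one step\<close>

definition d :: "nat \<Rightarrow> 'a" where
  "d k = y (Suc (Suc k)) - y (Suc k)"

text \<open>What the decrease estimate leaves in front of |d|^2. Its positivity is the upper bound
  on \<alpha>, multiplied by the denominator \<open>2 + \<gamma> * L\<^sub>h\<close> and divided by
  2 \<gamma>.\<close>

definition c :: real where
  "c = (1/2 - \<gamma> * l\<^sub>f / 2 - \<gamma> * L\<^sub>h - (\<alpha> + (\<gamma> * L\<^sub>f)\<^sup>2) * (1 + \<gamma> * L\<^sub>h / 2)) / \<gamma>"

lemma c_pos: "0 < c"
proof -
  have "0 < 2 + \<gamma> * L\<^sub>h" using \<gamma>_pos L\<^sub>h_nonneg by (simp add: add_pos_nonneg)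
  then have "(\<alpha> + \<gamma>\<^sup>2 * L\<^sub>f\<^sup>2) * (2 + \<gamma> * L\<^sub>h) < 1 - \<gamma> * l\<^sub>f - 2 * \<gamma> * L\<^sub>h"
    using \<alpha>_less by (simp add: pos_less_divide_eq less_diff_eq)
  then have "0 < 1/2 - \<gamma> * l\<^sub>f / 2 - \<gamma> * L\<^sub>h - (\<alpha> + (\<gamma> * L\<^sub>f)\<^sup>2) * (1 + \<gamma> * L\<^sub>h / 2)"
    by (simp add: power_mult_distrib algebra_simps)
  then show ?thesis using \<gamma>_pos by (simp add: c_def)
qed

lemma norm_diff_grad_f: "norm (\<gamma> *\<^sub>R (grad f u - grad f v)) \<le> \<gamma> * L\<^sub>f * norm (u - v)"
  using lipschitz_onD[OF f_lip, of u v] \<gamma>_pos by (simp add: dist_norm mult_left_mono mult.assoc)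

lemma norm_diff_grad_h: "norm (\<gamma> *\<^sub>R (grad h u - grad h v)) \<le> \<gamma> * L\<^sub>h * norm (u - v)"
  using lipschitz_onD[OF h_lip, of u v] \<gamma>_pos by (simp add: dist_norm mult_left_mono mult.assoc)

text \<open>Sum of the two weak-convexity tangent inequalities, at \<open>u\<close> and at
  \<open>v\<close>.\<close>

lemma weak_monotonicity: "- l\<^sub>f * (norm (u - v))\<^sup>2 \<le> (grad f u - grad f v) \<bullet> (u - v)"
  using weakly_convex_above_tangent[OF f_diff f_weakly_convex, of u v]
    weakly_convex_above_tangent[OF f_diff f_weakly_convex, of v u]
  by (simp add: norm_minus_commute[of v u] inner_diff_left inner_diff_right inner_commute)

text \<open>The step-size condition forces \<open>\<alpha> \<le> 1/2\<close> unless \<open>l\<^sub>f < 0\<close>; then \<open>\<nabla>f\<close> is monotone.\<close>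

lemma \<alpha>_cases: "\<alpha> \<le> 1/2 \<or> \<alpha> \<le> 3/4 \<and> 0 \<le> (\<gamma> *\<^sub>R (grad f u - grad f v)) \<bullet> (u - v)"
proof -
  define a where "a = \<gamma> * L\<^sub>f"
  have a: "0 \<le> a" using \<gamma>_pos L\<^sub>f_nonneg by (simp add: a_def)
  have "\<alpha> + a\<^sup>2 \<le> (\<alpha> + a\<^sup>2) * (1 + \<gamma> * L\<^sub>h / 2)"
    using \<alpha>_nonneg \<gamma>_pos L\<^sub>h_nonneg by (simp add: distrib_left)
  moreover have "0 \<le> \<gamma> * L\<^sub>h" using \<gamma>_pos L\<^sub>h_nonneg by simp
  moreover have "0 < c * \<gamma>" using c_pos \<gamma>_pos by simp
  ultimately have b: "\<alpha> + a\<^sup>2 < 1/2 - \<gamma> * l\<^sub>f / 2"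
    using \<gamma>_pos by (simp add: c_def a_def)
  show ?thesis
  proof (cases "0 \<le> l\<^sub>f")
    case True
    then have "0 \<le> \<gamma> * l\<^sub>f" using \<gamma>_pos by simp
    then show ?thesis using b zero_le_power2[of a] by linarith
  next
    case False
    \<comment> \<open>Testing on a unit vector shows \<open>- l\<^sub>f \<le> L\<^sub>f\<close>, so
      a negative \<open>l\<^sub>f\<close> cannot relax the bound on \<alpha> too far.\<close>
    obtain e :: 'a where e: "e \<in> Basis" using nonempty_Basis by blast
    have "- l\<^sub>f \<le> (grad f e - grad f 0) \<bullet> e"
      using weak_monotonicity[of e 0] e by simp
    also have "\<dots> \<le> norm (grad f e - grad f 0) * norm e" by (rule norm_cauchy_schwarz)
    also have "\<dots> \<le> L\<^sub>f" using lipschitz_onD[OF f_lip, of e 0] e by (simp add: dist_norm)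
    finally have "\<gamma> * (- l\<^sub>f) \<le> a" unfolding a_def using \<gamma>_pos by (intro mult_left_mono) auto
    then have "\<alpha> + a\<^sup>2 < 1/2 + a / 2" using b by simp
    \<comment> \<open>The maximum of a / 2 - a^2 is attained at a = 1/4, which gives \<alpha> <
      9/16.\<close>
    moreover have "0 \<le> (a - 1/4)\<^sup>2" by simp
    ultimately have "\<alpha> \<le> 3/4" by (simp add: power2_eq_square algebra_simps)
    moreover have "0 \<le> - l\<^sub>f * (norm (u - v))\<^sup>2" using False by (simp add: mult_nonpos_nonneg)
    then have "0 \<le> (grad f u - grad f v) \<bullet> (u - v)" using weak_monotonicity by (rule order_trans)
    ultimately show ?thesis using \<gamma>_pos by simp
  qed
qed

text \<open>Two expressions for \<open>w\<close>, one from proximal optimality in \<open>y\<close>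
  and one from the extrapolation in \<open>x\<close>, tie the increments of \<open>y\<close> to
  those of \<open>x\<close>.\<close>

lemma w_increment:
  "d k + \<gamma> *\<^sub>R (grad f (y (Suc (Suc k))) - grad f (y (Suc k)))
    = (1 + \<alpha>) *\<^sub>R q (Suc k) - \<alpha> *\<^sub>R q k"
proof -
  have "d k + \<gamma> *\<^sub>R (grad f (y (Suc (Suc k))) - grad f (y (Suc k))) = w (Suc k) - w k"
    unfolding w_y d_def by (simp add: algebra_simps)
  also have "\<dots> = (1 + \<alpha>) *\<^sub>R q (Suc k) - \<alpha> *\<^sub>R q k"
    unfolding w_eq by (simp add: q_def algebra_simps)
  finally show ?thesis .
qed

text \<open>\<open>w_increment\<close> solved for \<open>q (Suc k)\<close>. As \<alpha> / (1 +
  \<alpha>) is below 1, the increments of \<open>x\<close> inherit summability from those of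
  \<open>y\<close>.\<close>

lemma norm_q_Suc:
  "norm (q (Suc k)) \<le> \<alpha> / (1 + \<alpha>) * norm (q k) + (1 + \<gamma> * L\<^sub>f) / (1 + \<alpha>) * norm (d k)"
proof -
  have "(1 + \<alpha>) *\<^sub>R q (Suc k)
      = d k + \<gamma> *\<^sub>R (grad f (y (Suc (Suc k))) - grad f (y (Suc k))) + \<alpha> *\<^sub>R q k"
    unfolding w_increment by simp
  then have "(1 + \<alpha>) * norm (q (Suc k))
      = norm (d k + \<gamma> *\<^sub>R (grad f (y (Suc (Suc k))) - grad f (y (Suc k))) + \<alpha> *\<^sub>R q k)"
    using \<alpha>_nonneg by (metis abs_of_nonneg add_nonneg_nonneg norm_scaleR zero_le_one)
  also have "\<dots> \<le> norm (d k) + norm (\<gamma> *\<^sub>R (grad f (y (Suc (Suc k))) - grad f (y (Suc k))))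
      + norm (\<alpha> *\<^sub>R q k)"
    by (intro norm_triangle_le add_mono norm_triangle_ineq order_refl)
  also have "\<dots> \<le> norm (d k) + \<gamma> * L\<^sub>f * norm (d k) + \<alpha> * norm (q k)"
    using norm_diff_grad_f[of "y (Suc (Suc k))" "y (Suc k)"] \<alpha>_nonneg
    by (simp add: d_def del: norm_scaleR) simp
  finally have "norm (q (Suc k)) \<le> (norm (d k) + \<gamma> * L\<^sub>f * norm (d k) + \<alpha> * norm (q k)) / (1 + \<alpha>)"
    using \<alpha>_nonneg by (simp add: pos_le_divide_eq mult.commute)
  then show ?thesis by (simp add: add_divide_distrib distrib_right)
qed

lemma sufficient_decrease: "\<Theta> (Suc k) + c * (norm (d k))\<^sup>2 \<le> \<Theta> k"
proof -
  define v v' where "v = y (Suc k)" and "v' = y (Suc (Suc k))"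
  define Z where "Z = z (Suc k)"
  define u t where "u = \<gamma> *\<^sub>R (grad f v' - grad f v)" and "t = \<gamma> *\<^sub>R (grad h v' - grad h v)"
  define Q where "Q = q (Suc k)"
  have d: "d k = v' - v" by (simp add: d_def v_def v'_def)
  have \<delta>: "d k + u = (1 + \<alpha>) *\<^sub>R Q - \<alpha> *\<^sub>R q k"
    using w_increment[of k] by (simp add: u_def Q_def v_def v'_def)
  then have p: "\<alpha> *\<^sub>R q k = (1 + \<alpha>) *\<^sub>R Q - d k - u" by (simp add: algebra_simps)
  have Z: "Z - v = d k + u - \<alpha> *\<^sub>R Q"
    using z_minus_y[of k] unfolding Z_def v_def p by (simp add: Q_def algebra_simps)
  \<comment> \<open>\<open>Z\<close> is the minimizer in the envelope at \<open>v\<close> and merely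
    a competitor at \<open>v'\<close>; subtraction cancels \<open>\<psi> Z\<close>.\<close>
  have E': "envelope v' \<le> f v' + h v' + (Z - v') \<bullet> G v' + \<psi> Z / \<gamma> + (norm (Z - v'))\<^sup>2 / (2 * \<gamma>)"
    by (rule envelope_le)
  have E: "envelope v = f v + h v + (Z - v) \<bullet> G v + \<psi> Z / \<gamma> + (norm (Z - v))\<^sup>2 / (2 * \<gamma>)"
    by (rule envelope_eq) (simp add: Z_def v_def z_eq)
  have "envelope v' - envelope v \<le> f v' - f v + (h v' - h v)
      + (Z - v') \<bullet> G v' - (Z - v) \<bullet> G v + ((norm (Z - v'))\<^sup>2 - (norm (Z - v))\<^sup>2) / (2 * \<gamma>)"
    using E E' by (simp add: diff_divide_distrib)
  then have "\<gamma> * (envelope v' - envelope v) \<le> \<gamma> * (f v' - f v + (h v' - h v)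
      + (Z - v') \<bullet> G v' - (Z - v) \<bullet> G v + ((norm (Z - v'))\<^sup>2 - (norm (Z - v))\<^sup>2) / (2 * \<gamma>))"
    using \<gamma>_pos by (intro mult_left_mono) auto
  \<comment> \<open>The tangent error of \<open>f\<close> is taken at \<open>v'\<close> and that of
    \<open>h\<close> at \<open>v\<close>: weak convexity bounds the first from above, the descent
    lemma the second.\<close>
  also have "\<dots> = \<gamma> * (f v' - f v - d k \<bullet> grad f v') + \<gamma> * (h v' - h v - d k \<bullet> grad h v)
      + (u - d k) \<bullet> (Z - v) + t \<bullet> (Z - v - d k) + (norm (d k))\<^sup>2 / 2"
    using \<gamma>_pos unfolding d u_def t_def G_def power2_norm_eq_inner
    by (simp add: inner_add_left inner_add_right inner_diff_left inner_diff_right inner_commute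
        field_simps)
  also have "\<dots> \<le> \<gamma> * (l\<^sub>f / 2 * (norm (d k))\<^sup>2) + \<gamma> * (L\<^sub>h / 2 * (norm (d k))\<^sup>2)
      + (u - d k) \<bullet> (Z - v) + t \<bullet> (Z - v - d k) + (norm (d k))\<^sup>2 / 2"
  proof (intro add_mono mult_left_mono order_refl)
    show "f v' - f v - d k \<bullet> grad f v' \<le> l\<^sub>f / 2 * (norm (d k))\<^sup>2"
      using weakly_convex_above_tangent[OF f_diff f_weakly_convex, of v' v]
      by (simp add: d inner_diff_left norm_minus_commute)
    show "h v' - h v - d k \<bullet> grad h v \<le> L\<^sub>h / 2 * (norm (d k))\<^sup>2"
      using descent_lemma[OF h_diff h_lip, of v' v] by (simp add: d)
  qed (use \<gamma>_pos in auto)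
  finally have "\<gamma> * (envelope v' - envelope v) \<le> (1 / 2 + \<gamma> * l\<^sub>f / 2 + \<gamma> * L\<^sub>h / 2) * (norm (d k))\<^sup>2
      + (u - d k) \<bullet> (d k + u - \<alpha> *\<^sub>R Q) + t \<bullet> (u - \<alpha> *\<^sub>R Q)"
    unfolding Z by (simp add: algebra_simps)
  moreover have "(u - d k) \<bullet> (d k + u - \<alpha> *\<^sub>R Q) + t \<bullet> (u - \<alpha> *\<^sub>R Q)
      + (norm (\<alpha> *\<^sub>R Q))\<^sup>2 / 2 - (norm (\<alpha> *\<^sub>R q k))\<^sup>2 / 2
      \<le> (\<alpha> + (\<gamma> * L\<^sub>f)\<^sup>2 - 1 + \<gamma> * L\<^sub>h / 2 * (1 + (\<gamma> * L\<^sub>f)\<^sup>2 + \<alpha>)) * (norm (d k))\<^sup>2"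
    unfolding p
  proof (rule extrapolated_step_bound)
    show "\<alpha> \<le> 1/2 \<or> \<alpha> \<le> 3/4 \<and> 0 \<le> u \<bullet> d k" unfolding u_def d by (rule \<alpha>_cases)
    show "norm u \<le> \<gamma> * L\<^sub>f * norm (d k)" unfolding u_def d by (rule norm_diff_grad_f)
    show "norm t \<le> \<gamma> * L\<^sub>h * norm (d k)" unfolding t_def d by (rule norm_diff_grad_h)
    show "\<gamma> * L\<^sub>h \<le> 1"
      using \<gamma>_less mult_nonneg_nonneg[OF less_imp_le[OF \<gamma>_pos] L\<^sub>f_nonneg] by (simp add: algebra_simps)
  qed (use \<alpha>_nonneg \<gamma>_pos L\<^sub>h_nonneg in auto)
  ultimately have "\<gamma> * (envelope v' - envelope v) + (norm (\<alpha> *\<^sub>R Q))\<^sup>2 / 2 - (norm (\<alpha> *\<^sub>R q k))\<^sup>2 / 2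
      \<le> (1 / 2 + \<gamma> * l\<^sub>f / 2 + \<gamma> * L\<^sub>h / 2 + (\<alpha> + (\<gamma> * L\<^sub>f)\<^sup>2 - 1
          + \<gamma> * L\<^sub>h / 2 * (1 + (\<gamma> * L\<^sub>f)\<^sup>2 + \<alpha>))) * (norm (d k))\<^sup>2"
    by (simp only: distrib_right)
  also have "1 / 2 + \<gamma> * l\<^sub>f / 2 + \<gamma> * L\<^sub>h / 2 + (\<alpha> + (\<gamma> * L\<^sub>f)\<^sup>2 - 1
          + \<gamma> * L\<^sub>h / 2 * (1 + (\<gamma> * L\<^sub>f)\<^sup>2 + \<alpha>)) = - (\<gamma> * c)"
    using \<gamma>_pos by (simp add: c_def field_simps)
  finally have "\<gamma> * (\<Theta> (Suc k) + c * (norm (d k))\<^sup>2) \<le> \<gamma> * \<Theta> k"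
    using \<gamma>_pos by (simp add: \<Theta>_def Q_def algebra_simps flip: v_def v'_def)
  then show ?thesis using \<gamma>_pos by simp
qed

lemma \<Theta>_antimono: "\<Theta> (Suc k) \<le> \<Theta> k"
  using sufficient_decrease[of k] c_pos
  by (smt (verit) mult_nonneg_nonneg zero_le_power2)

lemma \<Theta>_converges: "\<exists>T. \<Theta> \<longlonglongrightarrow> T \<and> (\<forall>k. T \<le> \<Theta> k)"
proof -
  obtain B where B: "\<And>v. B \<le> envelope v" by (rule envelope_bounded_below) blast
  have "B \<le> \<Theta> k" for k
    unfolding \<Theta>_def using B[of "y (Suc k)"] \<gamma>_pos by (simp add: add_increasing2)
  moreover have "decseq \<Theta>" by (rule decseq_SucI) (rule \<Theta>_antimono)
  ultimately show ?thesis using decseq_convergent[of \<Theta> B] by blast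
qed

section \<open>Square summability of the increments\<close>

lemma summable_d: "summable (\<lambda>k. (norm (d k))\<^sup>2)"
proof -
  obtain T where T: "\<And>k. T \<le> \<Theta> k" using \<Theta>_converges by blast
  have "c * (\<Sum>k<m. (norm (d k))\<^sup>2) \<le> \<Theta> 0 - \<Theta> m" for m
  proof (induction m)
    case (Suc m)
    then show ?case using sufficient_decrease[of m] by (simp add: algebra_simps)
  qed simp
  then have "c * (\<Sum>k<Suc n. (norm (d k))\<^sup>2) \<le> \<Theta> 0 - T" for n
    using T by (meson diff_left_mono order_trans)
  then have "(\<Sum>k\<le>n. (norm (d k))\<^sup>2) \<le> (\<Theta> 0 - T) / c" for n
    using c_pos by (simp only: lessThan_Suc_atMost pos_le_divide_eq mult.commute)
  then show ?thesis by (intro bounded_imp_summable) auto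
qed

lemma summable_q: "summable (\<lambda>k. (norm (q k))\<^sup>2)"
  by (rule linear_recursion_summable_power2[OF _ _ _ norm_q_Suc summable_d])
    (use \<alpha>_nonneg in auto)

text \<open>Dropping two terms removes the undetermined \<open>y 0\<close> and the truncated index
  \<open>0 - 1\<close>; what remains is \<open>d\<close>.\<close>

lemma summable_y_diff: "summable (\<lambda>k. (norm (y k - y (k - 1)))\<^sup>2)"
  using summable_d by (subst summable_iff_shift[of _ 2, symmetric]) (simp add: d_def)

lemma summable_y_minus_z: "summable (\<lambda>k. (norm (y k - z k))\<^sup>2)"
proof -
  have "summable (\<lambda>k. (norm (y (k + 1) - z (k + 1)))\<^sup>2)"
  proof (rule summable_comparison_test')
    have "summable (\<lambda>k. (norm (q (Suc k)))\<^sup>2)"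
      using summable_q by (subst summable_Suc_iff)
    moreover have "summable (\<lambda>k. (\<alpha> * norm (q k))\<^sup>2)"
      using summable_q by (simp add: power_mult_distrib summable_mult)
    ultimately show "summable (\<lambda>k. (norm (q (Suc k)) + \<alpha> * norm (q k))\<^sup>2)"
      by (rule summable_power2_add)
    show "norm ((norm (y (k + 1) - z (k + 1)))\<^sup>2) \<le> (norm (q (Suc k)) + \<alpha> * norm (q k))\<^sup>2"
      if "k \<ge> 0" for k
    proof -
      have "norm (y (k + 1) - z (k + 1)) = norm (q (Suc k) - \<alpha> *\<^sub>R q k)"
        using z_minus_y[of k] by (metis Suc_eq_plus1 norm_minus_commute)
      also have "\<dots> \<le> norm (q (Suc k)) + \<alpha> * norm (q k)"
        using norm_triangle_ineq4[of "q (Suc k)" "\<alpha> *\<^sub>R q k"] \<alpha>_nonneg by simp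
      finally show ?thesis by (simp add: power_mono)
    qed
  qed
  then show ?thesis by (subst (asm) summable_iff_shift)
qed

section \<open>Vanishing increments and cluster points\<close>

lemma q_tendsto_0: "q \<longlonglongrightarrow> 0"
  using summable_power2_imp_tendsto_zero[OF summable_q] by (simp add: tendsto_norm_zero_iff)

lemma y_diff_tendsto_0: "(\<lambda>k. y k - y (k - 1)) \<longlonglongrightarrow> 0"
  using summable_power2_imp_tendsto_zero[OF summable_y_diff] by (simp add: tendsto_norm_zero_iff)

lemma y_minus_z_tendsto_0: "(\<lambda>k. y k - z k) \<longlonglongrightarrow> 0"
  using summable_power2_imp_tendsto_zero[OF summable_y_minus_z] by (simp add: tendsto_norm_zero_iff)

text \<open>\<open>y - z\<close> vanishes, and \<open>z = D (y - \<gamma> *\<^sub>R G y)\<close>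
  holds from index 1 on, so continuity carries the equation to the limit.\<close>

lemma y_cluster_point:
  assumes r: "strict_mono r" and y: "(\<lambda>k. y (r k)) \<longlonglongrightarrow> ys"
  shows "(\<lambda>k. z (r k)) \<longlonglongrightarrow> ys" "ys = D (ys - \<gamma> *\<^sub>R G ys)"
proof -
  have ev: "\<forall>\<^sub>F k in sequentially. 1 \<le> r k"
    using filterlim_subseq[OF r] by (simp add: filterlim_at_top)
  have "(\<lambda>k. y (r k) - z (r k)) \<longlonglongrightarrow> 0"
    using LIMSEQ_subseq_LIMSEQ[OF y_minus_z_tendsto_0 r] by (simp add: o_def)
  from tendsto_diff[OF y this] show z: "(\<lambda>k. z (r k)) \<longlonglongrightarrow> ys" by simp
  have "continuous_on UNIV (\<lambda>v. D (v - \<gamma> *\<^sub>R G v))"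
    by (intro continuous_intros continuous_on_compose2[OF continuous_D] continuous_G) auto
  then have "(\<lambda>k. D (y (r k) - \<gamma> *\<^sub>R G (y (r k)))) \<longlonglongrightarrow> D (ys - \<gamma> *\<^sub>R G ys)"
    using y by (rule continuous_on_tendsto_compose) auto
  moreover have "\<forall>\<^sub>F k in sequentially. D (y (r k) - \<gamma> *\<^sub>R G (y (r k))) = z (r k)"
    using ev
  proof eventually_elim
    case (elim k)
    then show ?case using z_eq[of "r k - 1"] by simp
  qed
  ultimately have "(\<lambda>k. z (r k)) \<longlonglongrightarrow> D (ys - \<gamma> *\<^sub>R G ys)"
    by (rule Lim_transform_eventually)
  then show "ys = D (ys - \<gamma> *\<^sub>R G ys)" using z LIMSEQ_unique by blast
qed

lemma cluster_point:
  assumes r: "strict_mono r" and lim: "(iterate y z x \<circ> r) \<longlonglongrightarrow> (ys, zs, xs, xs1, xs2)"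
  shows "xs1 = xs" "xs2 = xs" "ys = D (ys - \<gamma> *\<^sub>R G ys)"
proof -
  have y: "(\<lambda>k. y (r k)) \<longlonglongrightarrow> ys"
    and x: "(\<lambda>k. x (int (r k))) \<longlonglongrightarrow> xs"
    and x1: "(\<lambda>k. x (int (r k) - 1)) \<longlonglongrightarrow> xs1"
    and x2: "(\<lambda>k. x (int (r k) - 2)) \<longlonglongrightarrow> xs2"
    using tendsto_fst[OF lim] tendsto_fst[OF tendsto_snd[OF tendsto_snd[OF lim]]]
      tendsto_fst[OF tendsto_snd[OF tendsto_snd[OF tendsto_snd[OF lim]]]]
      tendsto_snd[OF tendsto_snd[OF tendsto_snd[OF tendsto_snd[OF lim]]]]
    by (simp_all add: iterate_def o_def)
  show "ys = D (ys - \<gamma> *\<^sub>R G ys)" using r y by (rule y_cluster_point)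
  have "(\<lambda>k. q (r k)) \<longlonglongrightarrow> 0"
    using LIMSEQ_subseq_LIMSEQ[OF q_tendsto_0 r] by (simp add: o_def)
  moreover have "(\<lambda>k. q (r k)) \<longlonglongrightarrow> xs - xs1"
    unfolding q_def by (intro tendsto_diff x x1)
  ultimately have "xs - xs1 = 0" using LIMSEQ_unique by blast
  then show 1: "xs1 = xs" by simp
  \<comment> \<open>The subtraction on naturals truncates only where \<open>r k = 0\<close>, which
    can happen at \<open>k = 0\<close> alone.\<close>
  have "filterlim (\<lambda>k. r k - 1) at_top at_top"
    using filterlim_minus_const_nat_at_top filterlim_subseq[OF r] by (rule filterlim_compose)
  then have "(\<lambda>k. q (r k - 1)) \<longlonglongrightarrow> 0"
    using q_tendsto_0 filterlim_compose by blast
  moreover have "(\<lambda>k. q (r k - 1)) \<longlonglongrightarrow> xs1 - xs2"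
  proof (rule Lim_transform_eventually)
    show "(\<lambda>k. x (int (r k) - 1) - x (int (r k) - 2)) \<longlonglongrightarrow> xs1 - xs2" by (intro tendsto_diff x1 x2)
    have "\<forall>\<^sub>F k in sequentially. 1 \<le> r k"
      using filterlim_subseq[OF r] by (simp add: filterlim_at_top)
    then show "\<forall>\<^sub>F k in sequentially. x (int (r k) - 1) - x (int (r k) - 2) = q (r k - 1)"
      by eventually_elim (simp add: q_def of_nat_diff)
  qed
  ultimately have "xs1 - xs2 = 0" using LIMSEQ_unique by blast
  then show "xs2 = xs" using 1 by simp
qed

text \<open>The fixed-point equation says \<open>Dinv v = v - \<gamma> *\<^sub>R G v\<close>, which
  makes the gradient of \<open>\<Phi>\<close> vanish.\<close>

lemma critical_point:
  assumes "v = D (v - \<gamma> *\<^sub>R G v)"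
  shows "0 \<in> limiting_subdifferential (objective f g h \<gamma>) v"
proof -
  have "Dinv v = v - \<gamma> *\<^sub>R G v" using assms by (metis Dinv_D)
  then show ?thesis
    using GDERIV_in_limiting_subdifferential[OF GDERIV_\<Phi>[of v]] by (simp add: objective_eq)
qed

end

section \<open>Convergence under the KL property\<close>

lemma concave_on_below_tangent:
  fixes \<phi> :: "real \<Rightarrow> real"
  assumes "concave_on {a..b} \<phi>" "a < t" "t < b" "s \<in> {a..b}" "(\<phi> has_real_derivative m) (at t)"
  shows "\<phi> s \<le> \<phi> t + m * (s - t)"
proof -
  have "(- m) * (s - t) \<le> (- \<phi> s) - (- \<phi> t)"
  proof (rule convex_on_imp_above_tangent)
    show "convex_on {a..b} (\<lambda>x. - \<phi> x)" using assms by (simp add: concave_on_def)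
    show "((\<lambda>x. - \<phi> x) has_real_derivative - m) (at t within {a..b})"
      using assms(5) by (intro DERIV_minus) (rule has_field_derivative_at_within)
  qed (use assms in auto)
  then show ?thesis by simp
qed

text \<open>Since the derivative of the desingularizing function is antitone, the KL inequality at level
  \<open>\<Psi> v - \<Psi> xs\<close> carries over to every smaller level \<open>t\<close>. This is what makes the KL
  property of the objective applicable to the merit function.\<close>

lemma KL_property_at_smoothE:
  fixes \<Psi> :: "'a::euclidean_space \<Rightarrow> real"
  assumes KL: "KL_property_at (\<lambda>v. ereal (\<Psi> v)) xs"
    and grad: "\<And>v. GDERIV \<Psi> v :> \<Psi>' v"
  obtains \<rho> b \<phi> where "0 < \<rho>" "0 < b" "continuous_on {0..b} \<phi>" "\<phi> 0 = 0"
    "\<And>s t. 0 \<le> s \<Longrightarrow> s \<le> t \<Longrightarrow> t < b \<Longrightarrow> \<phi> s \<le> \<phi> t"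
    "\<And>v s t. v \<in> ball xs \<rho> \<Longrightarrow> 0 \<le> s \<Longrightarrow> s \<le> t \<Longrightarrow> 0 < t \<Longrightarrow> t \<le> \<Psi> v - \<Psi> xs
      \<Longrightarrow> t - s \<le> (\<phi> t - \<phi> s) * norm (\<Psi>' v)"
proof -
  obtain \<eta> :: ereal and U \<phi> \<phi>' where \<eta>: "0 < \<eta>" and U: "open U" "xs \<in> U"
    and cont: "continuous_on {t. 0 \<le> t \<and> ereal t < \<eta>} \<phi>"
    and conc: "concave_on {t. 0 \<le> t \<and> ereal t < \<eta>} \<phi>"
    and \<phi>0: "\<phi> 0 = 0"
    and der: "\<And>t. 0 < t \<Longrightarrow> ereal t < \<eta> \<Longrightarrow> (\<phi> has_real_derivative \<phi>' t) (at t)"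
    and pos: "\<And>t. 0 < t \<Longrightarrow> ereal t < \<eta> \<Longrightarrow> 0 < \<phi>' t"
    and KL: "\<And>v. v \<in> U \<Longrightarrow> ereal (\<Psi> xs) < ereal (\<Psi> v) \<Longrightarrow> ereal (\<Psi> v) < ereal (\<Psi> xs) + \<eta> \<Longrightarrow>
      ereal (\<phi>' (real_of_ereal (ereal (\<Psi> v) - ereal (\<Psi> xs))))
        * edist 0 (limiting_subdifferential (\<lambda>v. ereal (\<Psi> v)) v) \<ge> 1"
    using KL unfolding KL_property_at_def by blast
  \<comment> \<open>A real level below \<eta>, which may be infinite, keeps \<open>{0..b}\<close>
    inside the domain of \<open>\<phi>\<close>.\<close>
  obtain b where b: "0 < b" "ereal b < \<eta>"
    using ereal_dense2[OF \<eta>] by (auto simp: zero_ereal_def)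
  have less_\<eta>: "ereal t < \<eta>" if "t \<le> b" for t
    using that b by (meson ereal_less_eq(3) le_less_trans)
  have sub: "{0..b} \<subseteq> {t. 0 \<le> t \<and> ereal t < \<eta>}" using less_\<eta> by auto
  have conc_b: "concave_on {0..b} \<phi>"
    using conc sub unfolding concave_on_def by (rule convex_on_subset) simp
  have tangent: "\<phi> s \<le> \<phi> t + \<phi>' t * (s - t)" if "0 \<le> s" "s \<le> b" "0 < t" "t < b" for s t
    using conc_b that less_\<eta> by (intro concave_on_below_tangent[of 0 b] der) auto
  have anti: "\<phi>' t \<le> \<phi>' s" if "0 < s" "s \<le> t" "t < b" for s t
  proof (cases "s = t")
    case False
    have "0 \<le> (\<phi>' s - \<phi>' t) * (t - s)"
      using tangent[of s t] tangent[of t s] that by (simp add: algebra_simps)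
    then show ?thesis using False that by (simp add: zero_le_mult_iff)
  qed simp
  have mono: "\<phi> s \<le> \<phi> t" if "0 \<le> s" "s \<le> t" "t < b" for s t
  proof (cases "s = t")
    case False
    then have "0 < t" using that by simp
    then have "\<phi>' t * (s - t) \<le> 0" using pos[of t] less_\<eta>[of t] that by (simp add: mult_nonneg_nonpos)
    then show ?thesis using tangent[of s t] that \<open>0 < t\<close> by simp
  qed simp
  \<comment> \<open>Continuity secures the upper level bound of the KL inequality on a small
    ball.\<close>
  have "isCont \<Psi> xs" using grad[of xs] unfolding gderiv_def by (rule has_derivative_continuous)
  then have "(\<Psi> \<longlongrightarrow> \<Psi> xs) (nhds xs)" by (simp add: isCont_def tendsto_at_iff_tendsto_nhds)
  then have "\<forall>\<^sub>F v in nhds xs. \<Psi> v < \<Psi> xs + b" using b by (intro order_tendstoD(2)) auto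
  moreover have "\<forall>\<^sub>F v in nhds xs. v \<in> U" using U by (rule eventually_nhds_in_open)
  ultimately have "\<forall>\<^sub>F v in nhds xs. \<Psi> v < \<Psi> xs + b \<and> v \<in> U" by (rule eventually_conj)
  then obtain \<rho> where \<rho>: "0 < \<rho>" "\<And>v. dist v xs < \<rho> \<Longrightarrow> \<Psi> v < \<Psi> xs + b \<and> v \<in> U"
    unfolding eventually_nhds_metric by blast
  show ?thesis
  proof (rule that[of \<rho> b \<phi>])
    show "continuous_on {0..b} \<phi>" using cont sub by (rule continuous_on_subset)
    show "0 < \<rho>" "0 < b" "\<phi> 0 = 0" by fact+
    show "\<phi> s \<le> \<phi> t" if "0 \<le> s" "s \<le> t" "t < b" for s t using that by (rule mono)
  next
    fix v s t
    assume v: "v \<in> ball xs \<rho>" and st: "0 \<le> s" "s \<le> t" "0 < t" "t \<le> \<Psi> v - \<Psi> xs"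
    define T where "T = \<Psi> v - \<Psi> xs"
    have T: "0 < T" "T < b" "v \<in> U" "t \<le> T" using v \<rho>(2)[of v] st by (auto simp: T_def dist_commute)
    have "ereal (\<Psi> v) < ereal (\<Psi> xs) + \<eta>"
    proof -
      have "ereal (\<Psi> v) = ereal (\<Psi> xs) + ereal T" by (simp add: T_def)
      also have "\<dots> < ereal (\<Psi> xs) + \<eta>" using less_\<eta>[of T] T by (cases \<eta>) auto
      finally show ?thesis .
    qed
    then have "1 \<le> ereal (\<phi>' T) * edist 0 (limiting_subdifferential (\<lambda>v. ereal (\<Psi> v)) v)"
      using KL[of v] T by (simp add: T_def)
    also have "\<dots> \<le> ereal (\<phi>' T) * ereal (norm (\<Psi>' v))"
    proof (rule ereal_mult_left_mono)
      show "edist 0 (limiting_subdifferential (\<lambda>v. ereal (\<Psi> v)) v) \<le> ereal (norm (\<Psi>' v))"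
        unfolding edist_def
        by (rule INF_lower2[OF GDERIV_in_limiting_subdifferential[OF grad]]) simp
      show "0 \<le> ereal (\<phi>' T)" using pos[of T] less_\<eta>[of T] T by simp
    qed
    finally have "1 \<le> \<phi>' T * norm (\<Psi>' v)" by (simp add: one_ereal_def)
    \<comment> \<open>Antitonicity of \<open>\<phi>'\<close> lowers the level from \<open>T\<close>
      to \<open>t\<close>; the tangent at \<open>t\<close> then turns the derivative into a
      difference of values of \<open>\<phi>\<close>.\<close>
    also have "\<dots> \<le> \<phi>' t * norm (\<Psi>' v)" using anti[of t T] T st by (intro mult_right_mono) auto
    finally have "(t - s) * 1 \<le> (t - s) * (\<phi>' t * norm (\<Psi>' v))" using st by (intro mult_left_mono) auto
    also have "\<dots> = (\<phi>' t * (t - s)) * norm (\<Psi>' v)" by simp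
    also have "\<dots> \<le> (\<phi> t - \<phi> s) * norm (\<Psi>' v)"
      using tangent[of s t] st T by (intro mult_right_mono) (auto simp: algebra_simps)
    finally show "t - s \<le> (\<phi> t - \<phi> s) * norm (\<Psi>' v)" by simp
  qed
qed

section \<open>Finite length of the iterates\<close>

context pnp_dys
begin

lemma \<gamma>_L\<^sub>f: "0 \<le> \<gamma> * L\<^sub>f" "\<gamma> * L\<^sub>f \<le> 1"
proof -
  show "0 \<le> \<gamma> * L\<^sub>f" using \<gamma>_pos L\<^sub>f_nonneg by simp
  have "0 \<le> \<gamma> * L\<^sub>h" using \<gamma>_pos L\<^sub>h_nonneg by simp
  then show "\<gamma> * L\<^sub>f \<le> 1" using \<gamma>_less by (simp add: distrib_left)
qed

lemma \<alpha>_le_1: "\<alpha> \<le> 1"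
  using \<alpha>_cases by fastforce

text \<open>Since \<open>z = D (y - \<gamma> *\<^sub>R G y)\<close>, the gradient is the difference
  of \<open>Dinv y\<close> and \<open>Dinv z\<close> divided by \<gamma>, and \<open>Dinv\<close> is
  Lipschitz.\<close>

lemma norm_grad_\<Phi>_le:
  "norm ((1 / \<gamma>) *\<^sub>R (Dinv (y (Suc k)) - (y (Suc k) - \<gamma> *\<^sub>R G (y (Suc k)))))
    \<le> 1 / (\<gamma> * (1 - L)) * (norm (q (Suc k)) + norm (q k))"
proof -
  let ?v = "y (Suc k)"
  have "norm (Dinv ?v - (?v - \<gamma> *\<^sub>R G ?v)) \<le> norm (?v - z (Suc k)) / (1 - L)"
    using norm_Dinv[of ?v "z (Suc k)"] by (simp add: z_eq)
  also have "norm (?v - z (Suc k)) = norm (q (Suc k) - \<alpha> *\<^sub>R q k)"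
    using z_minus_y[of k] by (metis norm_minus_commute)
  also have "\<dots> \<le> norm (q (Suc k)) + norm (\<alpha> *\<^sub>R q k)" by (rule norm_triangle_ineq4)
  also have "\<dots> \<le> norm (q (Suc k)) + norm (q k)"
    using \<alpha>_nonneg \<alpha>_le_1 by (simp add: mult_left_le_one_le)
  finally have "norm (Dinv ?v - (?v - \<gamma> *\<^sub>R G ?v)) \<le> (norm (q (Suc k)) + norm (q k)) / (1 - L)"
    using L_less_1 by (simp add: divide_right_mono)
  then have "1 / \<gamma> * norm (Dinv ?v - (?v - \<gamma> *\<^sub>R G ?v))
      \<le> 1 / \<gamma> * ((norm (q (Suc k)) + norm (q k)) / (1 - L))"
    using \<gamma>_pos by (intro mult_left_mono) auto
  then show ?thesis using \<gamma>_pos by (simp only: norm_scaleR) simp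
qed

text \<open>Summation of \<open>norm_q_Suc\<close> from \<open>K\<close> on; the constants come from
  1 - \<alpha> / (1 + \<alpha>) = 1 / (1 + \<alpha>), \<alpha> \<le> 1 and
  \<open>\<gamma> * L\<^sub>f \<le> 1\<close>.\<close>

lemma q_finite_length:
  shows "(\<Sum>j<n. norm (q (K + j)))
      \<le> 2 * norm (q K) + 2 * (\<Sum>j<n. norm (d (K + j)))" (is "?q \<le> _ + 2 * ?d")
    and "(\<Sum>j<n. norm (q (Suc (K + j))))
      \<le> 2 * norm (q K) + 4 * (\<Sum>j<n. norm (d (K + j)))" (is "?q' \<le> _")
proof -
  have a: "0 < 1 + \<alpha>" using \<alpha>_nonneg by simp
  have "(1 - \<alpha> / (1 + \<alpha>)) * ?q \<le> norm (q (K + 0)) + (1 + \<gamma> * L\<^sub>f) / (1 + \<alpha>) * ?d"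
    by (rule linear_recursion_sum_le) (use norm_q_Suc in auto)
  then have "?q / (1 + \<alpha>) \<le> norm (q K) + (1 + \<gamma> * L\<^sub>f) / (1 + \<alpha>) * ?d"
    using a by (simp add: field_simps)
  then have "?q \<le> (1 + \<alpha>) * (norm (q K) + (1 + \<gamma> * L\<^sub>f) / (1 + \<alpha>) * ?d)"
    using a by (simp add: divide_le_eq mult.commute)
  also have "\<dots> = (1 + \<alpha>) * norm (q K) + (1 + \<gamma> * L\<^sub>f) * ?d"
    using a by (simp add: field_simps)
  also have "\<dots> \<le> 2 * norm (q K) + 2 * ?d"
    using \<alpha>_le_1 \<gamma>_L\<^sub>f by (intro add_mono mult_right_mono sum_nonneg) auto
  finally show 1: "?q \<le> 2 * norm (q K) + 2 * ?d" .
  have "norm (q (Suc k)) \<le> norm (q k) + 2 * norm (d k)" for k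
  proof -
    have "(1 + \<gamma> * L\<^sub>f) / (1 + \<alpha>) \<le> 2" "\<alpha> / (1 + \<alpha>) \<le> 1"
      using a \<alpha>_nonneg \<gamma>_L\<^sub>f by (simp_all add: divide_le_eq)
    then have "\<alpha> / (1 + \<alpha>) * norm (q k) + (1 + \<gamma> * L\<^sub>f) / (1 + \<alpha>) * norm (d k)
        \<le> 1 * norm (q k) + 2 * norm (d k)"
      by (intro add_mono mult_right_mono) auto
    then show ?thesis using norm_q_Suc[of k] by simp
  qed
  then have "?q' \<le> (\<Sum>j<n. norm (q (K + j)) + 2 * norm (d (K + j)))"
    by (intro sum_mono)
  then show "?q' \<le> 2 * norm (q K) + 4 * ?d"
    using 1 by (simp add: sum.distrib flip: sum_distrib_left)
qed

lemma bounded_y: "bounded (range (\<lambda>k. y (Suc k)))"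
proof -
  have "bounded (fst ` (\<lambda>k. (y k, z k, x (int k))) ` {1..})"
    using bounded_iterates by (rule bounded_fst)
  then show ?thesis by (rule bounded_subset) (auto simp: image_image)
qed

lemma finite_length:
  assumes KL: "KL_function (objective f g h \<gamma>)"
  shows "summable (\<lambda>k. norm (d k))"
proof -
  obtain ys r where r: "strict_mono r" and ys: "((\<lambda>k. y (Suc k)) \<circ> r) \<longlonglongrightarrow> ys"
    using bounded_imp_convergent_subsequence[OF bounded_y] by blast
  have fixp: "ys = D (ys - \<gamma> *\<^sub>R G ys)"
    using r ys by (intro y_cluster_point(2)[of "\<lambda>k. Suc (r k)"]) (auto simp: strict_mono_def o_def)
  have KL_ys: "KL_property_at (\<lambda>v. ereal (\<Phi> v)) ys"
    using KL critical_point[OF fixp] unfolding KL_function_def objective_eq by blast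
  obtain \<rho> b \<phi> where \<rho>: "0 < \<rho>" and b: "0 < b" and cont: "continuous_on {0..b} \<phi>" and \<phi>0: "\<phi> 0 = 0"
    and mono: "\<And>s t. 0 \<le> s \<Longrightarrow> s \<le> t \<Longrightarrow> t < b \<Longrightarrow> \<phi> s \<le> \<phi> t"
    and KL: "\<And>v s t. v \<in> ball ys \<rho> \<Longrightarrow> 0 \<le> s \<Longrightarrow> s \<le> t \<Longrightarrow> 0 < t \<Longrightarrow> t \<le> \<Phi> v - \<Phi> ys
      \<Longrightarrow> t - s \<le> (\<phi> t - \<phi> s) * norm ((1 / \<gamma>) *\<^sub>R (Dinv v - (v - \<gamma> *\<^sub>R G v)))"
  proof (rule KL_property_at_smoothE[OF KL_ys GDERIV_\<Phi>], goal_cases)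
    case (1 \<rho> b \<phi>)
    show ?case by (rule that[of \<rho> b \<phi>]) (fact 1(2-))+
  qed
  obtain T where T: "\<Theta> \<longlonglongrightarrow> T" "\<And>k. T \<le> \<Theta> k" using \<Theta>_converges by blast
  \<comment> \<open>Along \<open>r\<close> the extrapolation term vanishes and the envelope tends to
    its value at the fixed point \<open>ys\<close>, where it agrees with \<open>\<Phi>\<close>. So
    the merit gap is measured from the level of the KL inequality.\<close>
  have "T = \<Phi> ys"
  proof -
    have "(\<lambda>k. envelope (y (Suc (r k)))) \<longlonglongrightarrow> envelope ys"
      using ys by (intro continuous_on_tendsto_compose[OF continuous_envelope, of _ ys]) (auto simp: o_def)
    moreover have "(\<lambda>k. q (r k)) \<longlonglongrightarrow> 0"
      using LIMSEQ_subseq_LIMSEQ[OF q_tendsto_0 r] by (simp add: o_def)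
    ultimately have "(\<lambda>k. \<Theta> (r k)) \<longlonglongrightarrow> envelope ys + (norm (\<alpha> *\<^sub>R (0::'a)))\<^sup>2 / (2 * \<gamma>)"
      unfolding \<Theta>_def by (intro tendsto_intros) (use \<gamma>_pos in auto)
    moreover have "(\<lambda>k. \<Theta> (r k)) \<longlonglongrightarrow> T"
      using LIMSEQ_subseq_LIMSEQ[OF T(1) r] by (simp add: o_def)
    ultimately show ?thesis using LIMSEQ_unique envelope_eq_\<Phi>[OF fixp] by fastforce
  qed
  define t where "t k = \<Theta> k - T" for k
  have t_nonneg: "0 \<le> t k" for k using T by (simp add: t_def)
  have t_Suc: "t (Suc k) \<le> t k" for k using \<Theta>_antimono by (simp add: t_def)
  have t_mono: "t k \<le> t K" if "K \<le> k" for k K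
    using that t_Suc by (rule lift_Suc_antimono_le[rotated])
  have t_lim: "t \<longlonglongrightarrow> 0" using tendsto_diff[OF T(1) tendsto_const[of T]] by (simp add: t_def[abs_def])
  define S where "S k = \<phi> (t k / 2) + sqrt (t k)" for k
  \<comment> \<open>\<open>A\<close> is the constant of \<open>norm_grad_\<Phi>_le\<close>;
    \<open>B\<close> bounds \<open>sqrt (t k)\<close> when the extrapolation term dominates.\<close>
  define A B where "A = 1 / (\<gamma> * (1 - L))" and "B = 1 / sqrt \<gamma>"
  have AB: "0 < A" "0 < B" using \<gamma>_pos L_less_1 by (auto simp: A_def B_def)
  define M where "M = 2 * (A + B) / c"
  have M: "0 < M" using AB c_pos by (simp add: M_def)
  \<comment> \<open>The weights satisfy 4 * (1/12) * (3 M) = M, as the arithmetic-geometric mean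
    inequality requires, and 1/12 is small enough for the increments of \<open>x\<close> to be
    absorbed after summation.\<close>
  have step: "norm (d k) \<le> (norm (q (Suc k)) + norm (q k)) / 12 + 3 * M * (S k - S (Suc k))"
    if v: "y (Suc k) \<in> ball ys \<rho>" and tb: "t k < b" for k
  proof -
    define X where "X = norm (q (Suc k)) + norm (q k)"
    have X: "0 \<le> X" by (simp add: X_def)
    have d\<phi>: "\<phi> (t (Suc k) / 2) \<le> \<phi> (t k / 2)"
      using t_nonneg[of k] t_nonneg[of "Suc k"] t_Suc[of k] tb by (intro mono) auto
    have dsqrt: "sqrt (t (Suc k)) \<le> sqrt (t k)" using t_Suc by simp
    have dS: "\<phi> (t k / 2) - \<phi> (t (Suc k) / 2) \<le> S k - S (Suc k)"
      "sqrt (t k) - sqrt (t (Suc k)) \<le> S k - S (Suc k)" "0 \<le> S k - S (Suc k)"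
      unfolding S_def using d\<phi> dsqrt by linarith+
    have "t k - t (Suc k) \<le> 2 * (A + B) * X * (S k - S (Suc k))"
    proof (cases "t k = 0")
      case True
      then have "t (Suc k) = 0" using t_nonneg[of "Suc k"] t_Suc[of k] by simp
      then show ?thesis using True by (simp add: S_def)
    next
      case False
      then have tk: "0 < t k" using t_nonneg[of k] by simp
      \<comment> \<open>At least half of \<open>t k\<close> stems from one of the two summands of
        \<open>\<Theta>\<close>.\<close>
      consider "t k / 2 \<le> envelope (y (Suc k)) - T" | "t k / 2 \<le> (norm (\<alpha> *\<^sub>R q k))\<^sup>2 / (2 * \<gamma>)"
        unfolding t_def \<Theta>_def by argo
      then show ?thesis
      proof cases
        case 1
        \<comment> \<open>As the envelope lies below \<open>\<Phi>\<close>, the level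
          \<open>t k / 2\<close> is below the actual gap of \<open>\<Phi>\<close>, where the KL
          inequality still applies.\<close>
        have "t k / 2 - t (Suc k) / 2 \<le> (\<phi> (t k / 2) - \<phi> (t (Suc k) / 2))
            * norm ((1 / \<gamma>) *\<^sub>R (Dinv (y (Suc k)) - (y (Suc k) - \<gamma> *\<^sub>R G (y (Suc k)))))"
          using 1 v tk t_nonneg[of "Suc k"] t_Suc[of k] envelope_le_\<Phi>[of "y (Suc k)"] \<open>T = \<Phi> ys\<close>
          by (intro KL) auto
        also have "\<dots> \<le> (\<phi> (t k / 2) - \<phi> (t (Suc k) / 2)) * (A * X)"
          using norm_grad_\<Phi>_le[of k] d\<phi> by (intro mult_left_mono) (auto simp: A_def X_def)
        also have "\<dots> \<le> (S k - S (Suc k)) * ((A + B) * X)"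
          using dS AB X by (intro mult_mono mult_right_mono) auto
        finally show ?thesis by (simp add: algebra_simps)
      next
        case 2
        \<comment> \<open>In this case the square root desingularizes: \<open>sqrt (t k)\<close> is
          at most a multiple of \<open>X\<close>, and the decrease factors as a difference of
          squares.\<close>
        have "norm (\<alpha> *\<^sub>R q k) \<le> X"
          using \<alpha>_nonneg \<alpha>_le_1 by (simp add: X_def mult_left_le_one_le add_increasing)
        then have "t k \<le> X\<^sup>2 / \<gamma>"
          using 2 \<gamma>_pos power_mono[of "norm (\<alpha> *\<^sub>R q k)" X 2] by (simp add: field_simps)
        then have sq: "sqrt (t k) \<le> B * X"
          using real_sqrt_le_mono[of "t k" "X\<^sup>2 / \<gamma>"] X by (simp add: B_def real_sqrt_divide)
        have "t k - t (Suc k) = (sqrt (t k))\<^sup>2 - (sqrt (t (Suc k)))\<^sup>2"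
          using t_nonneg by simp
        also have "\<dots> = (sqrt (t k) - sqrt (t (Suc k))) * (sqrt (t k) + sqrt (t (Suc k)))"
          by (simp add: power2_eq_square algebra_simps)
        also have "\<dots> \<le> (S k - S (Suc k)) * (2 * ((A + B) * X))"
        proof (rule mult_mono)
          have "B * X \<le> (A + B) * X" using AB X by (intro mult_right_mono) auto
          then show "sqrt (t k) + sqrt (t (Suc k)) \<le> 2 * ((A + B) * X)" using sq dsqrt by linarith
        qed (use dS t_nonneg in auto)
        finally show ?thesis by (simp add: algebra_simps)
      qed
    qed
    moreover have "c * (norm (d k))\<^sup>2 \<le> t k - t (Suc k)"
      using sufficient_decrease[of k] by (simp add: t_def)
    ultimately have "c * (norm (d k))\<^sup>2 \<le> 2 * (A + B) * X * (S k - S (Suc k))" by linarith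
    then have "(norm (d k))\<^sup>2 \<le> M * X * (S k - S (Suc k))"
      using c_pos by (simp add: M_def field_simps)
    also have "\<dots> \<le> (X / 12 + 3 * M * (S k - S (Suc k)))\<^sup>2"
      using zero_le_power2[of "X / 12 - 3 * M * (S k - S (Suc k))"]
      by (simp add: power2_eq_square algebra_simps)
    finally have "norm (d k) \<le> X / 12 + 3 * M * (S k - S (Suc k))"
      by (rule power2_le_imp_le) (use X M dS(3) in simp)
    then show ?thesis by (simp add: X_def)
  qed
  have S_nonneg: "0 \<le> S k" if "t k < b" for k
    using mono[of 0 "t k / 2"] t_nonneg[of k] that by (simp add: S_def \<phi>0)
  have S_lim: "S \<longlonglongrightarrow> 0"
  proof -
    have "(\<lambda>k. \<phi> (t k / 2)) \<longlonglongrightarrow> \<phi> 0"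
    proof (rule continuous_on_tendsto_compose[OF cont])
      have t2: "(\<lambda>k. t k / 2) \<longlonglongrightarrow> 0" using tendsto_divide_zero[OF t_lim] .
      then show "(\<lambda>k. t k / 2) \<longlonglongrightarrow> 0" .
      have "\<forall>\<^sub>F k in sequentially. t k / 2 < b" using t2 b by (rule order_tendstoD(2))
      then show "\<forall>\<^sub>F k in sequentially. t k / 2 \<in> {0..b}"
        by eventually_elim (use t_nonneg in simp)
    qed (use b in simp)
    moreover have "(\<lambda>k. sqrt (t k)) \<longlonglongrightarrow> sqrt 0" using t_lim by (rule tendsto_real_sqrt)
    ultimately show ?thesis unfolding S_def[abs_def] using tendsto_add[of _ "\<phi> 0" _ _ "sqrt 0"] by (simp add: \<phi>0)
  qed
  \<comment> \<open>By \<open>q_finite_length\<close> the two sums of \<open>q\<close> are at most 4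
    |q K| plus 6 times the sum of \<open>d\<close>; division by 12 leaves half of the latter, which
    moves to the left.\<close>
  have length: "(\<Sum>j<n. norm (d (K + j))) \<le> norm (q K) + 6 * M * S K"
    if K: "t K < b" and n: "\<And>j. j < n \<Longrightarrow> y (Suc (K + j)) \<in> ball ys \<rho>" for K n
  proof -
    let ?d = "\<Sum>j<n. norm (d (K + j))"
    have tb: "t (K + j) < b" for j using t_mono[of K "K + j"] K by simp
    have "?d \<le> (\<Sum>j<n. (norm (q (Suc (K + j))) + norm (q (K + j))) / 12
        + 3 * M * (S (K + j) - S (Suc (K + j))))"
      by (intro sum_mono step n tb) simp
    also have "\<dots> = ((\<Sum>j<n. norm (q (Suc (K + j)))) + (\<Sum>j<n. norm (q (K + j)))) / 12
        + 3 * M * (\<Sum>j<n. S (K + j) - S (K + Suc j))"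
      by (simp add: sum.distrib sum_distrib_left flip: sum_divide_distrib)
    also have "(\<Sum>j<n. S (K + j) - S (K + Suc j)) = S K - S (K + n)"
      using sum_lessThan_telescope'[of "\<lambda>j. S (K + j)" n] by simp
    also have "\<dots> \<le> S K" using S_nonneg[OF tb] by simp
    finally have "?d \<le> ((\<Sum>j<n. norm (q (Suc (K + j)))) + (\<Sum>j<n. norm (q (K + j)))) / 12 + 3 * M * S K"
      using M by (simp add: mult_left_mono)
    then show ?thesis using q_finite_length[of K n] norm_ge_zero[of "q K"] by argo
  qed
  \<comment> \<open>\<open>K\<close> is taken on the subsequence so that \<open>y (Suc K)\<close> is
    within \<rho> / 2 of \<open>ys\<close> and the bound on the remaining length is below \<rho> /
    2.\<close>
  have "(\<lambda>k. norm (q (r k)) + 6 * M * S (r k)) \<longlonglongrightarrow> norm (0::'a) + 6 * M * 0"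
    using LIMSEQ_subseq_LIMSEQ[OF q_tendsto_0 r] LIMSEQ_subseq_LIMSEQ[OF S_lim r]
    by (intro tendsto_intros) (auto simp: o_def)
  then have "\<forall>\<^sub>F k in sequentially. norm (q (r k)) + 6 * M * S (r k) < \<rho> / 2"
    using \<rho> by (intro order_tendstoD(2)[where y = "norm (0::'a) + 6 * M * 0"]) auto
  moreover have "\<forall>\<^sub>F k in sequentially. t (r k) < b"
    using LIMSEQ_subseq_LIMSEQ[OF t_lim r] b by (auto simp: o_def dest: order_tendstoD(2))
  moreover have "\<forall>\<^sub>F k in sequentially. dist (y (Suc (r k))) ys < \<rho> / 2"
    using tendstoD[OF ys, of "\<rho> / 2"] \<rho> by (simp add: o_def)
  ultimately have "\<forall>\<^sub>F k in sequentially. norm (q (r k)) + 6 * M * S (r k) < \<rho> / 2 \<and> t (r k) < b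
      \<and> dist (y (Suc (r k))) ys < \<rho> / 2"
    by eventually_elim simp
  then obtain K where K: "norm (q K) + 6 * M * S K < \<rho> / 2" "t K < b" "dist (y (Suc K)) ys < \<rho> / 2"
    by (metis (mono_tags, lifting) eventually_happens trivial_limit_sequentially)
  \<comment> \<open>If all points before the \<open>n\<close>-th lie in the ball, the length bound
    applies up to \<open>n\<close> and keeps the \<open>n\<close>-th point in the ball as
    well.\<close>
  have in_ball: "y (Suc (K + n)) \<in> ball ys \<rho>" for n
  proof (induction n rule: less_induct)
    case (less n)
    have "norm (y (Suc (K + n)) - y (Suc K)) = norm (\<Sum>j<n. d (K + j))"
      using sum_lessThan_telescope[of "\<lambda>j. y (Suc (K + j))" n] by (simp add: d_def)
    also have "\<dots> \<le> (\<Sum>j<n. norm (d (K + j)))" by (rule norm_sum)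
    also have "\<dots> \<le> norm (q K) + 6 * M * S K" using K(2) less by (rule length)
    finally have "dist (y (Suc (K + n))) (y (Suc K)) < \<rho> / 2" using K(1) by (simp add: dist_norm)
    then have "dist (y (Suc (K + n))) ys < \<rho>" 
      using K(3) dist_triangle[of "y (Suc (K + n))" ys "y (Suc K)"] by linarith
    then show ?case by (simp add: dist_commute)
  qed
  have "summable (\<lambda>j. norm (d (K + j)))"
  proof (rule bounded_imp_summable)
    show "(\<Sum>j\<le>n. norm (d (K + j))) \<le> norm (q K) + 6 * M * S K" for n
      using length[OF K(2) in_ball, of "Suc n"] by (simp add: lessThan_Suc_atMost)
  qed simp
  then show ?thesis by (subst summable_iff_shift[of _ K, symmetric]) (simp add: add.commute)
qed

section \<open>Convergence of the whole sequence\<close>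

lemma convergent_iterate:
  assumes "KL_function (objective f g h \<gamma>)"
  shows "convergent (iterate y z x)"
proof -
  have d: "summable (\<lambda>k. norm (d k))" using assms by (rule finite_length)
  then have "convergent (\<lambda>k. y (Suc k))"
    by (intro convergent_if_summable_diff) (simp add: d_def)
  then obtain ys where y: "y \<longlonglongrightarrow> ys"
    by (auto simp: convergent_def filterlim_sequentially_Suc)
  have z: "z \<longlonglongrightarrow> ys"
    using tendsto_diff[OF y y_minus_z_tendsto_0] by simp
  have "summable (\<lambda>k. norm (q k))"
  proof (rule bounded_imp_summable)
    \<comment> \<open>The initial term of \<open>q_finite_length\<close> vanishes because the first
      two values of \<open>x\<close> coincide.\<close>
    show "(\<Sum>k\<le>n. norm (q k)) \<le> 2 * (\<Sum>k. norm (d k))" for n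
    proof -
      have "(\<Sum>k<Suc n. norm (q k)) \<le> 2 * (\<Sum>k<Suc n. norm (d k))"
        using q_finite_length(1)[where n = "Suc n" and K = 0] by (simp only: q_0 add_0 norm_zero mult_zero_right)
      also have "\<dots> \<le> 2 * (\<Sum>k. norm (d k))"
        by (intro mult_left_mono sum_le_suminf d) auto
      finally show ?thesis by (simp add: lessThan_Suc_atMost)
    qed
  qed simp
  then have "summable (\<lambda>k. norm (q (Suc k)))" by (subst summable_Suc_iff)
  then have "convergent (\<lambda>k. x (int k))"
    by (intro convergent_if_summable_diff) (simp add: q_def)
  then obtain xs where x: "(\<lambda>k. x (int k)) \<longlonglongrightarrow> xs" by (auto simp: convergent_def)
  have x1: "(\<lambda>k. x (int k - 1)) \<longlonglongrightarrow> xs"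
    using tendsto_diff[OF x q_tendsto_0] by (simp add: q_def)
  have x2: "(\<lambda>k. x (int k - 2)) \<longlonglongrightarrow> xs"
    by (subst filterlim_sequentially_Suc[symmetric]) (use x1 in simp)
  have "iterate y z x \<longlonglongrightarrow> (ys, ys, xs, xs, xs)"
    unfolding iterate_def by (intro tendsto_Pair y z x x1 x2)
  then show ?thesis by (rule convergentI)
qed

end

theorem theorem4p2:
  fixes f g h :: "real ^ 'n \<Rightarrow> real"
    and L L\<^sub>f L\<^sub>h l\<^sub>f \<alpha> \<gamma> :: real
    and w y z :: "nat \<Rightarrow> real ^ 'n" and x :: "int \<Rightarrow> real ^ 'n"
  assumes g_C2: "C2 g"
    and g_lip: "L-lipschitz_on UNIV (grad g)" and L_less_1: "L < 1"
    and f_diff: "\<forall>v. f differentiable (at v)" and f_lip: "L\<^sub>f-lipschitz_on UNIV (grad f)"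
    and h_diff: "\<forall>v. h differentiable (at v)" and h_lip: "L\<^sub>h-lipschitz_on UNIV (grad h)"
    and f_weakly_convex: "convex_on UNIV (\<lambda>v. f v + l\<^sub>f / 2 * (norm v)\<^sup>2)"
    and bounded_below: "bdd_below (range f)" "bdd_below (range g)" "bdd_below (range h)"
    and \<gamma>: "0 < \<gamma>" "\<gamma> * (L\<^sub>f + L\<^sub>h) < 1"
    and \<alpha>: "0 \<le> \<alpha>" "\<alpha> < (1 - \<gamma> * l\<^sub>f - 2 * \<gamma> * L\<^sub>h) / (2 + \<gamma> * L\<^sub>h) - \<gamma>\<^sup>2 * L\<^sub>f\<^sup>2"
    and iteration: "smooth_ePnP_DYS f g h \<alpha> \<gamma> w y z x"
    and bounded_iterates: "bounded ((\<lambda>k. (y k, z k, x (int k))) ` {1..})"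
  shows
    "((\<forall>k\<ge>1. merit_Theta f g h \<alpha> \<gamma> (iterate y z x (k + 1)) \<le> merit_Theta f g h \<alpha> \<gamma> (iterate y z x k))
        \<and> (\<exists>c::real. (\<lambda>k. merit_Theta f g h \<alpha> \<gamma> (iterate y z x k)) \<longlonglongrightarrow> ereal c))
     \<and>
     ((\<lambda>k::nat. x (int k) - x (int k - 1)) \<longlonglongrightarrow> 0
        \<and> (\<lambda>k. y k - y (k - 1)) \<longlonglongrightarrow> 0
        \<and> (\<lambda>k. y k - z k) \<longlonglongrightarrow> 0
        \<and> (\<lambda>K::nat. Min ((\<lambda>k. norm (x (int k) - x (int k - 1))) ` {1..K})) \<in> O(\<lambda>K. 1 / sqrt (real K))
        \<and> (\<lambda>K::nat. Min ((\<lambda>k. norm (y k - y (k - 1))) ` {2..K})) \<in> O(\<lambda>K. 1 / sqrt (real K))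
        \<and> (\<lambda>K::nat. Min ((\<lambda>k. norm (y k - z k)) ` {1..K})) \<in> O(\<lambda>K. 1 / sqrt (real K)))
     \<and>
     (\<forall>ys zs xs xs1 xs2.
        (\<exists>r. strict_mono r \<and> (iterate y z x \<circ> r) \<longlonglongrightarrow> (ys, zs, xs, xs1, xs2)) \<longrightarrow>
          xs1 = xs \<and> xs2 = xs \<and> 0 \<in> limiting_subdifferential (objective f g h \<gamma>) ys)
     \<and>
     (C2 h \<and> (\<exists>M>0. \<forall>v. norm (Hess h v) \<le> M) \<and> KL_function (objective f g h \<gamma>) \<longrightarrow>
        convergent (iterate y z x))"
proof -
  interpret pnp_dys g L f h L\<^sub>f L\<^sub>h l\<^sub>f \<alpha> \<gamma> w y z x
    by unfold_locales (use assms in \<open>auto simp: C2_def\<close>)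
  have "merit_Theta f g h \<alpha> \<gamma> (iterate y z x (k + 1)) \<le> merit_Theta f g h \<alpha> \<gamma> (iterate y z x k)"
    if "k \<ge> 1" for k
    \<comment> \<open>\<open>\<Theta>\<close> starts at 0 and the merit sequence at 1, hence the
      predecessor.\<close>
    using that merit_Theta_eq[of k] merit_Theta_eq[of "k - 1"] \<Theta>_antimono[of "k - 1"] by simp
  moreover have "\<exists>c::real. (\<lambda>k. merit_Theta f g h \<alpha> \<gamma> (iterate y z x k)) \<longlonglongrightarrow> ereal c"
  proof -
    obtain T where "\<Theta> \<longlonglongrightarrow> T" using \<Theta>_converges by blast
    then have "(\<lambda>k. merit_Theta f g h \<alpha> \<gamma> (iterate y z x (Suc k))) \<longlonglongrightarrow> ereal T"
      by (simp add: merit_Theta_eq)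
    then have "(\<lambda>k. merit_Theta f g h \<alpha> \<gamma> (iterate y z x k)) \<longlonglongrightarrow> ereal T"
      by (rule LIMSEQ_imp_Suc)
    then show ?thesis by blast
  qed
  moreover note q_tendsto_0[unfolded q_def] y_diff_tendsto_0 y_minus_z_tendsto_0
    Min_bigo_of_summable_power2[OF norm_ge_zero summable_q[unfolded q_def], of 1]
    Min_bigo_of_summable_power2[OF norm_ge_zero summable_y_diff, of 2]
    Min_bigo_of_summable_power2[OF norm_ge_zero summable_y_minus_z, of 1]
  moreover have "xs1 = xs \<and> xs2 = xs \<and> 0 \<in> limiting_subdifferential (objective f g h \<gamma>) ys"
    if "strict_mono r \<and> (iterate y z x \<circ> r) \<longlonglongrightarrow> (ys, zs, xs, xs1, xs2)" for r ys zs xs xs1 xs2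
    using cluster_point[of r ys zs xs xs1 xs2] critical_point[of ys] that by blast
  moreover note convergent_iterate
  ultimately show ?thesis by blast
qed

end
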